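(* Let $T:\mathbb{M}\to\mathbb{T}$ and $T':\mathbb{M}\to\mathbb{T}'$ be second-order algebraic theories and $F:\mathbb{T}\to\mathbb{T}'$ an algebraic translation from $T$ to $T'$. Then the algebraic functor $\mathrm{FunMod}(T',\mathrm{Set})\to\mathrm{FunMod}(T,\mathrm{Set})$, $S\mapsto S\circ F$, has a left adjoint.
   Context: $\mathbb{M}$: objects are finite sequences $\langle m_1,\dots,m_k\rangle\in\mathbb{N}^*$; a morphism $\langle m_1,\dots,m_k\rangle\to\langle n_1,\dots,n_\ell\rangle$ is a tuple $\langle t_1,\dots,t_\ell\rangle$ where $t_i$ is a second-order term with no operators in context $\mathsf{m}_1:[m_1],\dots,\mathsf{m}_k:[m_k]\rhd x_1,\dots,x_{n_i}$, i.e. generated by variables $x_j$ and metavariable applications $\mathsf{m}_i[s_1,\dots,s_{m_i}]$; identities are $\langle\mathsf{m}_i[x_1,\dots,x_{m_i}]\rangle_i$ and the composite of $\langle s_p\rangle_{p\le j}:\langle l_1,\dots,l_i\rangle\to\langle m_1,\dots,m_j\rangle$ then $\langle t_q\rangle_q$ is $\langle t_q\{\mathsf{m}_p:=(x_1,\dots,x_{m_p})s_p\}_p\rangle_q$, where metasubstitution replaces each $\mathsf{m}_p[u_1,\dots,u_{m_p}]$ by $s_p$ with $x_r$ substituted by the (metasubstituted) $u_r$. $\mathbb{M}$ is strict cartesian (products by concatenation) and $\langle0\rangle$ is exponentiable with $\langle0\rangle\Rightarrow\langle m_1,\dots,m_k\rangle=\langle m_1+1,\dots,m_k+1\rangle$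 and evaluation $\langle\mathsf{m}_i[x_1,\dots,x_{m_i},\mathsf{m}_{k+1}[\,]]\rangle_{i\le k}$. A second-order algebraic theory is a cartesian category $\mathbb{T}$ with a strict cartesian identity-on-objects functor $T:\mathbb{M}\to\mathbb{T}$ preserving the exponentiable object $\langle0\rangle$. An algebraic translation $T\to T'$ is a functor $F:\mathbb{T}\to\mathbb{T}'$ with $T'=F\circ T$. $\mathrm{FunMod}(T,\mathrm{Set})$ is the category of cartesian (finite-product-preserving) functors $\mathbb{T}\to\mathrm{Set}$ and natural transformations between them. *)

theory Defs
  imports Main "HOL-Library.FuncSet"
begin

section \<open>Categories, functors, adjunctions\<close>

record ('o, 'm) cat =
  Obj :: "'o set"
  Arr :: "'m set"
  Dom :: "'m \<Rightarrow> 'o"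
  Cod :: "'m \<Rightarrow> 'o"
  Ident :: "'o \<Rightarrow> 'm"
  Comp :: "'m \<Rightarrow> 'm \<Rightarrow> 'm"  \<comment> \<open>\<open>Comp C g f\<close> is first \<open>f\<close>, then \<open>g\<close>\<close>

definition hom :: "('o, 'm, 'z) cat_scheme \<Rightarrow> 'o \<Rightarrow> 'o \<Rightarrow> 'm set" where
  "hom C x y = {f \<in> Arr C. Dom C f = x \<and> Cod C f = y}"

definition category :: "('o, 'm, 'z) cat_scheme \<Rightarrow> bool" where
  "category C \<longleftrightarrow>
     (\<forall>f\<in>Arr C. Dom C f \<in> Obj C \<and> Cod C f \<in> Obj C) \<and>
     (\<forall>x\<in>Obj C. Ident C x \<in> hom C x x) \<and>
     (\<forall>f\<in>Arr C. \<forall>g\<in>Arr C. Cod C f = Dom C g \<longrightarrow> Comp C g f \<in> hom C (Dom C f) (Cod C g)) \<and>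
     (\<forall>f\<in>Arr C. Comp C f (Ident C (Dom C f)) = f \<and> Comp C (Ident C (Cod C f)) f = f) \<and>
     (\<forall>f\<in>Arr C. \<forall>g\<in>Arr C. \<forall>h\<in>Arr C. Cod C f = Dom C g \<longrightarrow> Cod C g = Dom C h \<longrightarrow>
        Comp C h (Comp C g f) = Comp C (Comp C h g) f)"

record ('o, 'm, 'p, 'n) func =
  on_obj :: "'o \<Rightarrow> 'p"
  on_arr :: "'m \<Rightarrow> 'n"

text \<open>Functors are extensional (equal to \<^const>\<open>undefined\<close> off the objects and arrows of their
  domain), so that HOL equality of functors is equality of functors in the mathematical sense.\<close>

definition is_functor ::
  "('o, 'm, 'z) cat_scheme \<Rightarrow> ('p, 'n, 'y) cat_scheme \<Rightarrow> ('o, 'm, 'p, 'n) func \<Rightarrow> bool" where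
  "is_functor C D F \<longleftrightarrow>
     category C \<and> category D \<and>
     on_obj F \<in> Obj C \<rightarrow>\<^sub>E Obj D \<and>
     on_arr F \<in> Arr C \<rightarrow>\<^sub>E Arr D \<and>
     (\<forall>f\<in>Arr C. Dom D (on_arr F f) = on_obj F (Dom C f) \<and>
                Cod D (on_arr F f) = on_obj F (Cod C f)) \<and>
     (\<forall>x\<in>Obj C. on_arr F (Ident C x) = Ident D (on_obj F x)) \<and>
     (\<forall>f\<in>Arr C. \<forall>g\<in>Arr C. Cod C f = Dom C g \<longrightarrow>
        on_arr F (Comp C g f) = Comp D (on_arr F g) (on_arr F f))"

definition func_comp ::
  "('o, 'm, 'z) cat_scheme \<Rightarrow> ('p, 'n, 'q, 'r) func \<Rightarrow> ('o, 'm, 'p, 'n) func \<Rightarrow> ('o, 'm, 'q, 'r) func"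
where
  "func_comp C G F = \<lparr>on_obj = compose (Obj C) (on_obj G) (on_obj F),
                      on_arr = compose (Arr C) (on_arr G) (on_arr F)\<rparr>"

definition adjunction ::
  "('o, 'm, 'z) cat_scheme \<Rightarrow> ('p, 'n, 'y) cat_scheme \<Rightarrow>
   ('o, 'm, 'p, 'n) func \<Rightarrow> ('p, 'n, 'o, 'm) func \<Rightarrow> ('o \<Rightarrow> 'p \<Rightarrow> 'n \<Rightarrow> 'm) \<Rightarrow> bool" where
  "adjunction C D L G \<phi> \<longleftrightarrow>
     is_functor C D L \<and> is_functor D C G \<and>
     (\<forall>c\<in>Obj C. \<forall>d\<in>Obj D. bij_betw (\<phi> c d) (hom D (on_obj L c) d) (hom C c (on_obj G d))) \<and>
     (\<forall>c\<in>Obj C. \<forall>c'\<in>Obj C. \<forall>d\<in>Obj D. \<forall>d'\<in>Obj D.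
        \<forall>h\<in>hom C c' c. \<forall>k\<in>hom D d d'. \<forall>f\<in>hom D (on_obj L c) d.
          \<phi> c' d' (Comp D k (Comp D f (on_arr L h))) =
            Comp C (on_arr G k) (Comp C (\<phi> c d f) h))"

definition has_left_adjoint ::
  "('p, 'n, 'y) cat_scheme \<Rightarrow> ('o, 'm, 'z) cat_scheme \<Rightarrow> ('p, 'n, 'o, 'm) func \<Rightarrow> bool" where
  "has_left_adjoint D C G \<longleftrightarrow> (\<exists>L \<phi>. adjunction C D L G \<phi>)"


section \<open>Finite products and exponentials\<close>

definition is_terminal :: "('o, 'm, 'z) cat_scheme \<Rightarrow> 'o \<Rightarrow> bool" where
  "is_terminal C t \<longleftrightarrow> t \<in> Obj C \<and> (\<forall>c\<in>Obj C. \<exists>!f. f \<in> hom C c t)"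

definition is_product ::
  "('o, 'm, 'z) cat_scheme \<Rightarrow> 'o \<Rightarrow> 'o \<Rightarrow> 'o \<Rightarrow> 'm \<Rightarrow> 'm \<Rightarrow> bool" where
  "is_product C a b p p1 p2 \<longleftrightarrow>
     a \<in> Obj C \<and> b \<in> Obj C \<and> p \<in> Obj C \<and> p1 \<in> hom C p a \<and> p2 \<in> hom C p b \<and>
     (\<forall>c\<in>Obj C. \<forall>f\<in>hom C c a. \<forall>g\<in>hom C c b.
        \<exists>!h. h \<in> hom C c p \<and> Comp C p1 h = f \<and> Comp C p2 h = g)"

definition preserves_finite_products ::
  "('o, 'm, 'z) cat_scheme \<Rightarrow> ('p, 'n, 'y) cat_scheme \<Rightarrow> ('o, 'm, 'p, 'n) func \<Rightarrow> bool" where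
  "preserves_finite_products C D F \<longleftrightarrow>
     (\<forall>t. is_terminal C t \<longrightarrow> is_terminal D (on_obj F t)) \<and>
     (\<forall>a b p p1 p2. is_product C a b p p1 p2 \<longrightarrow>
        is_product D (on_obj F a) (on_obj F b) (on_obj F p) (on_arr F p1) (on_arr F p2))"

record ('o, 'm) cartcat = "('o, 'm) cat" +
  One :: "'o"
  Prod :: "'o \<Rightarrow> 'o \<Rightarrow> 'o"
  Pr1 :: "'o \<Rightarrow> 'o \<Rightarrow> 'm"
  Pr2 :: "'o \<Rightarrow> 'o \<Rightarrow> 'm"

definition cartesian_category :: "('o, 'm, 'z) cartcat_scheme \<Rightarrow> bool" where
  "cartesian_category C \<longleftrightarrow>
     category C \<and> is_terminal C (One C) \<and>
     (\<forall>a\<in>Obj C. \<forall>b\<in>Obj C. is_product C a b (Prod C a b) (Pr1 C a b) (Pr2 C a b))"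

definition strict_cartesian_functor ::
  "('o, 'm, 'z) cartcat_scheme \<Rightarrow> ('p, 'n, 'y) cartcat_scheme \<Rightarrow> ('o, 'm, 'p, 'n) func \<Rightarrow> bool"
where
  "strict_cartesian_functor C D F \<longleftrightarrow>
     is_functor C D F \<and>
     on_obj F (One C) = One D \<and>
     (\<forall>a\<in>Obj C. \<forall>b\<in>Obj C.
        on_obj F (Prod C a b) = Prod D (on_obj F a) (on_obj F b) \<and>
        on_arr F (Pr1 C a b) = Pr1 D (on_obj F a) (on_obj F b) \<and>
        on_arr F (Pr2 C a b) = Pr2 D (on_obj F a) (on_obj F b))"

definition pairing :: "('o, 'm, 'z) cartcat_scheme \<Rightarrow> 'm \<Rightarrow> 'm \<Rightarrow> 'm" where
  "pairing C f g = (THE h. h \<in> hom C (Dom C f) (Prod C (Cod C f) (Cod C g)) \<and>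
     Comp C (Pr1 C (Cod C f) (Cod C g)) h = f \<and> Comp C (Pr2 C (Cod C f) (Cod C g)) h = g)"

text \<open>\<open>e\<close> with evaluation \<open>ev : e \<times> a \<rightarrow> b\<close> is an exponential \<open>a \<Rightarrow> b\<close>; the \<^const>\<open>pairing\<close> below
  is \<open>g \<times> id\<^sub>a\<close>.\<close>

definition is_exponential ::
  "('o, 'm, 'z) cartcat_scheme \<Rightarrow> 'o \<Rightarrow> 'o \<Rightarrow> 'o \<Rightarrow> 'm \<Rightarrow> bool" where
  "is_exponential C a b e ev \<longleftrightarrow>
     a \<in> Obj C \<and> b \<in> Obj C \<and> e \<in> Obj C \<and> ev \<in> hom C (Prod C e a) b \<and>
     (\<forall>c\<in>Obj C. \<forall>f\<in>hom C (Prod C c a) b.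
        \<exists>!g. g \<in> hom C c e \<and>
             Comp C ev (pairing C (Comp C g (Pr1 C c a)) (Pr2 C c a)) = f)"

definition preserves_exponentiable ::
  "('o, 'm, 'z) cartcat_scheme \<Rightarrow> ('p, 'n, 'y) cartcat_scheme \<Rightarrow>
   ('o, 'm, 'p, 'n) func \<Rightarrow> 'o \<Rightarrow> bool" where
  "preserves_exponentiable C D F a \<longleftrightarrow>
     (\<forall>b e ev. is_exponential C a b e ev \<longrightarrow>
        is_exponential D (on_obj F a) (on_obj F b) (on_obj F e) (on_arr F ev))"


section \<open>The category M of second-order terms without operators\<close>

text \<open>An arrow that carries its domain and codomain.\<close>

datatype ('o, 'f) arrow = Arrow (src: 'o) (arr: 'f) (tgt: 'o)

text \<open>Variables and metavariables are numbered from \<open>0\<close>.\<close>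

datatype trm = Var nat | MVar nat "trm list"

text \<open>\<open>wf_trm ms n t\<close>: \<open>t\<close> is a term in metavariable context \<open>ms\<close> with variables among the first
  \<open>n\<close> ones.\<close>

fun wf_trm :: "nat list \<Rightarrow> nat \<Rightarrow> trm \<Rightarrow> bool" where
  "wf_trm ms n (Var j) \<longleftrightarrow> j < n"
| "wf_trm ms n (MVar i ts) \<longleftrightarrow> i < length ms \<and> length ts = ms ! i \<and> (\<forall>t\<in>set ts. wf_trm ms n t)"

fun subst :: "trm list \<Rightarrow> trm \<Rightarrow> trm" where
  "subst us (Var j) = us ! j"
| "subst us (MVar i ts) = MVar i (map (subst us) ts)"

fun msubst :: "trm list \<Rightarrow> trm \<Rightarrow> trm" where
  "msubst ss (Var j) = Var j"
| "msubst ss (MVar p us) = subst (map (msubst ss) us) (ss ! p)"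

definition MM :: "(nat list, (nat list, trm list) arrow) cartcat" where
  "MM = \<lparr>Obj = UNIV,
         Arr = {f. length (arr f) = length (tgt f) \<and>
                   (\<forall>i<length (tgt f). wf_trm (src f) (tgt f ! i) (arr f ! i))},
         Dom = src,
         Cod = tgt,
         Ident = (\<lambda>ms. Arrow ms (map (\<lambda>i. MVar i (map Var [0..<ms ! i])) [0..<length ms]) ms),
         Comp = (\<lambda>g f. Arrow (src f) (map (msubst (arr f)) (arr g)) (tgt g)),
         One = [],
         Prod = (@),
         Pr1 = (\<lambda>ms ns. Arrow (ms @ ns)
                  (map (\<lambda>i. MVar i (map Var [0..<ms ! i])) [0..<length ms]) ms),
         Pr2 = (\<lambda>ms ns. Arrow (ms @ ns)
                  (map (\<lambda>i. MVar (length ms + i) (map Var [0..<ns ! i])) [0..<length ns]) ns)\<rparr>"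

definition MM_eval :: "nat list \<Rightarrow> (nat list, trm list) arrow" where
  "MM_eval ms = Arrow (map Suc ms @ [0])
     (map (\<lambda>i. MVar i (map Var [0..<ms ! i] @ [MVar (length ms) []])) [0..<length ms]) ms"


subsection \<open>\<open>M\<close> is cartesian, with \<open>[0]\<close> exponentiable\<close>

lemma wf_subst:
  "wf_trm ms (length us) t \<Longrightarrow> (\<And>u. u \<in> set us \<Longrightarrow> wf_trm ms n u) \<Longrightarrow> wf_trm ms n (subst us t)"
  by (induction t) auto

lemma wf_weaken: "wf_trm ms n t \<Longrightarrow> n \<le> n' \<Longrightarrow> wf_trm (ms @ ls) n' t"
  by (induction t) (auto simp: nth_append)

lemma wf_msubst:
  assumes "length ss = length ms" "\<And>i. i < length ms \<Longrightarrow> wf_trm ls (ms ! i) (ss ! i)"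
  shows "wf_trm ms n t \<Longrightarrow> wf_trm ls n (msubst ss t)"
proof (induction t)
  case (MVar p us)
  then show ?case using assms by (auto intro!: wf_subst)
qed simp

lemma subst_subst:
  "wf_trm ms (length rs) t \<Longrightarrow> subst us (subst rs t) = subst (map (subst us) rs) t"
  by (induction t) auto

lemma subst_Vars: "wf_trm ms n t \<Longrightarrow> subst (map Var [0..<n]) t = t"
  by (induction t) (auto simp: map_idI)

lemma msubst_subst:
  assumes "length ss = length ms" "\<And>i. i < length ms \<Longrightarrow> wf_trm ls (ms ! i) (ss ! i)"
  shows "wf_trm ms (length us) t \<Longrightarrow>
    msubst ss (subst us t) = subst (map (msubst ss) us) (msubst ss t)"
proof (induction t)
  case (MVar p vs)
  have "msubst ss (subst us (MVar p vs)) =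
      subst (map (subst (map (msubst ss) us)) (map (msubst ss) vs)) (ss ! p)"
    using MVar by (auto intro!: arg_cong[where f = "\<lambda>x. subst x _"])
  also have "\<dots> = subst (map (msubst ss) us) (subst (map (msubst ss) vs) (ss ! p))"
    using MVar.prems assms by (subst subst_subst[of ls]) auto
  finally show ?case by simp
qed simp

lemma msubst_msubst:
  assumes "length ss = length ms" "\<And>i. i < length ms \<Longrightarrow> wf_trm ls (ms ! i) (ss ! i)"
    and "length rs = length ns" "\<And>i. i < length ns \<Longrightarrow> wf_trm ms (ns ! i) (rs ! i)"
  shows "wf_trm ns n t \<Longrightarrow> msubst ss (msubst rs t) = msubst (map (msubst ss) rs) t"
proof (induction t)
  case (MVar p us)
  have "msubst ss (msubst rs (MVar p us)) =
      subst (map (msubst ss) (map (msubst rs) us)) (msubst ss (rs ! p))"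
    using MVar.prems assms by (simp del: map_map) (subst msubst_subst[of _ ms ls], auto)
  also have "map (msubst ss) (map (msubst rs) us) = map (msubst (map (msubst ss) rs)) us"
    using MVar by auto
  finally show ?case using MVar.prems assms by simp
qed simp


lemma msubst_id:
  "wf_trm ms n t \<Longrightarrow> msubst (map (\<lambda>i. MVar i (map Var [0..<ms ! i])) [0..<length ms]) t = t"
proof (induction t)
  case (MVar p us)
  have "map (\<lambda>j. us ! j) [0..<length us] = us" by (rule map_nth)
  moreover have "map (msubst (map (\<lambda>i. MVar i (map Var [0..<ms ! i])) [0..<length ms])) us = us"
    using MVar by (auto simp: map_idI)
  ultimately show ?case using MVar.prems by (simp add: o_def cong: map_cong)
qed simp

lemma MM_sel [simp]:
  "Obj MM = UNIV" "Dom MM = src" "Cod MM = tgt" "One MM = []" "Prod MM = (@)"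
  "Comp MM g f = Arrow (src f) (map (msubst (arr f)) (arr g)) (tgt g)"
  by (simp_all add: MM_def)

lemma MM_ids:
  "Ident MM ms = Arrow ms (map (\<lambda>i. MVar i (map Var [0..<ms ! i])) [0..<length ms]) ms"
  "Pr1 MM ms ns = Arrow (ms @ ns) (map (\<lambda>i. MVar i (map Var [0..<ms ! i])) [0..<length ms]) ms"
  "Pr2 MM ms ns = Arrow (ms @ ns)
     (map (\<lambda>i. MVar (length ms + i) (map Var [0..<ns ! i])) [0..<length ns]) ns"
  by (simp_all add: MM_def)

lemma MM_Arr: "f \<in> Arr MM \<longleftrightarrow> length (arr f) = length (tgt f) \<and>
    (\<forall>i<length (tgt f). wf_trm (src f) (tgt f ! i) (arr f ! i))"
  by (simp add: MM_def)

lemma MM_hom: "f \<in> hom MM ms ns \<longleftrightarrow> (\<exists>ts. f = Arrow ms ts ns \<and> length ts = length ns \<and>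
    (\<forall>i<length ns. wf_trm ms (ns ! i) (ts ! i)))"
  by (cases f) (auto simp: hom_def MM_Arr)

lemma MM_comp_hom: "f \<in> hom MM ls ms \<Longrightarrow> g \<in> hom MM ms ns \<Longrightarrow> Comp MM g f \<in> hom MM ls ns"
  by (auto simp: MM_hom intro!: wf_msubst)

lemma MM_id_hom: "Ident MM ms \<in> hom MM ms ms"
  by (auto simp: MM_hom MM_ids)

lemma category_MM: "category MM"
  unfolding category_def
proof (intro conjI ballI impI)
  fix f g assume "f \<in> Arr MM" "g \<in> Arr MM" "Cod MM f = Dom MM g"
  then show "Comp MM g f \<in> hom MM (Dom MM f) (Cod MM g)"
    using MM_comp_hom[of f "src f" "tgt f" g "tgt g"] by (auto simp: hom_def)
next
  fix f assume f: "f \<in> Arr MM"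
  show "Comp MM f (Ident MM (Dom MM f)) = f"
  proof -
    have "map (msubst (map (\<lambda>i. MVar i (map Var [0..<src f ! i])) [0..<length (src f)])) (arr f) = arr f"
      using f msubst_id by (fastforce simp: MM_Arr in_set_conv_nth intro!: map_idI)
    then show ?thesis by (simp add: MM_ids)
  qed
  show "Comp MM (Ident MM (Cod MM f)) f = f"
    using f by (cases f) (auto simp: MM_Arr MM_ids o_def intro!: nth_equalityI subst_Vars)
next
  fix f g h assume *: "f \<in> Arr MM" "g \<in> Arr MM" "h \<in> Arr MM"
    "Cod MM f = Dom MM g" "Cod MM g = Dom MM h"
  then show "Comp MM h (Comp MM g f) = Comp MM (Comp MM h g) f"
    using msubst_msubst[of "arr f" "src g" "src f" "arr g" "src h"]
    by (auto simp: MM_Arr in_set_conv_nth) metis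
qed (auto simp: MM_id_hom)

lemma Pr1_MM: "Pr1 MM ms ns \<in> hom MM (ms @ ns) ms"
  by (auto simp: MM_hom MM_ids nth_append)

lemma Pr2_MM: "Pr2 MM ms ns \<in> hom MM (ms @ ns) ns"
  by (auto simp: MM_hom MM_ids nth_append)

lemma Comp_Pr1_MM: "h \<in> hom MM ls (ms @ ns) \<Longrightarrow>
    Comp MM (Pr1 MM ms ns) h = Arrow ls (take (length ms) (arr h)) ms"
proof -
  assume "h \<in> hom MM ls (ms @ ns)"
  then obtain ts where h: "h = Arrow ls ts (ms @ ns)" "length ts = length ms + length ns"
     and wf: "\<And>i. i < length ms + length ns \<Longrightarrow> wf_trm ls ((ms @ ns) ! i) (ts ! i)"
    by (auto simp: MM_hom)
  have "subst (map Var [0..<ms ! i]) (ts ! i) = ts ! i"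
    if "i < length ms" for i
    using wf[of i] that by (auto simp: nth_append intro: subst_Vars)
  then show ?thesis using h by (auto simp: MM_ids o_def intro!: nth_equalityI)
qed

lemma Comp_Pr2_MM: "h \<in> hom MM ls (ms @ ns) \<Longrightarrow>
    Comp MM (Pr2 MM ms ns) h = Arrow ls (drop (length ms) (arr h)) ns"
proof -
  assume "h \<in> hom MM ls (ms @ ns)"
  then obtain ts where h: "h = Arrow ls ts (ms @ ns)" "length ts = length ms + length ns"
     and wf: "\<And>i. i < length ms + length ns \<Longrightarrow> wf_trm ls ((ms @ ns) ! i) (ts ! i)"
    by (auto simp: MM_hom)
  have "subst (map Var [0..<ns ! i]) (ts ! (length ms + i)) = ts ! (length ms + i)"
    if "i < length ns" for i
    using wf[of "length ms + i"] that by (auto simp: nth_append intro: subst_Vars)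
  then show ?thesis using h by (auto simp: MM_ids o_def intro!: nth_equalityI)
qed

lemma is_product_MM: "is_product MM ms ns (ms @ ns) (Pr1 MM ms ns) (Pr2 MM ms ns)"
  unfolding is_product_def
proof (intro conjI ballI)
  fix ls f g assume f: "f \<in> hom MM ls ms" and g: "g \<in> hom MM ls ns"
  show "\<exists>!h. h \<in> hom MM ls (ms @ ns) \<and> Comp MM (Pr1 MM ms ns) h = f \<and> Comp MM (Pr2 MM ms ns) h = g"
  proof (rule ex1I[of _ "Arrow ls (arr f @ arr g) (ms @ ns)"])
    have *: "Arrow ls (arr f @ arr g) (ms @ ns) \<in> hom MM ls (ms @ ns)"
      using f g by (auto simp: MM_hom nth_append)
    show "Arrow ls (arr f @ arr g) (ms @ ns) \<in> hom MM ls (ms @ ns) \<and>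
      Comp MM (Pr1 MM ms ns) (Arrow ls (arr f @ arr g) (ms @ ns)) = f \<and>
      Comp MM (Pr2 MM ms ns) (Arrow ls (arr f @ arr g) (ms @ ns)) = g"
      unfolding Comp_Pr1_MM[OF *] Comp_Pr2_MM[OF *] using * f g by (auto simp: MM_hom)
  next
    fix h assume h: "h \<in> hom MM ls (ms @ ns) \<and> Comp MM (Pr1 MM ms ns) h = f \<and> Comp MM (Pr2 MM ms ns) h = g"
    then have "f = Arrow ls (take (length ms) (arr h)) ms" "g = Arrow ls (drop (length ms) (arr h)) ns"
      using Comp_Pr1_MM[of h ls ms ns] Comp_Pr2_MM[of h ls ms ns] by auto
    then have "arr f @ arr g = arr h" by simp
    then show "h = Arrow ls (arr f @ arr g) (ms @ ns)"
      using h by (cases h) (auto simp: MM_hom simp del: MM_sel)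
  qed
qed (use Pr1_MM Pr2_MM in auto)

lemma cartesian_category_MM: "cartesian_category MM"
  by (auto simp: cartesian_category_def category_MM is_product_MM is_terminal_def MM_hom)

lemma pairing_MM:
  assumes "f \<in> hom MM ls ms" "g \<in> hom MM ls ns"
  shows "pairing MM f g = Arrow ls (arr f @ arr g) (ms @ ns)"
proof -
  have *: "Arrow ls (arr f @ arr g) (ms @ ns) \<in> hom MM ls (ms @ ns)"
    using assms by (auto simp: MM_hom nth_append)
  have "\<exists>!h. h \<in> hom MM ls (ms @ ns) \<and> Comp MM (Pr1 MM ms ns) h = f \<and> Comp MM (Pr2 MM ms ns) h = g"
    using is_product_MM[of ms ns] assms unfolding is_product_def by auto
  moreover have "Comp MM (Pr1 MM ms ns) (Arrow ls (arr f @ arr g) (ms @ ns)) = f"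
      "Comp MM (Pr2 MM ms ns) (Arrow ls (arr f @ arr g) (ms @ ns)) = g"
    unfolding Comp_Pr1_MM[OF *] Comp_Pr2_MM[OF *] using * assms by (auto simp: MM_hom)
  moreover have "Dom MM f = ls" "Cod MM f = ms" "Cod MM g = ns"
    using assms by (auto simp: hom_def)
  ultimately show ?thesis unfolding pairing_def using * by (auto intro!: the1_equality simp del: MM_sel simp: MM_sel(5))
qed

text \<open>Currying an arrow \<open>ls @ [0] \<rightarrow> [n]\<close>: the last metavariable becomes the last variable.\<close>

fun abstr :: "nat \<Rightarrow> nat \<Rightarrow> trm \<Rightarrow> trm" where
  "abstr l n (Var j) = Var j"
| "abstr l n (MVar i ts) = (if i = l then Var n else MVar i (map (abstr l n) ts))"

lemma wf_abstr: "wf_trm (ls @ [0]) n t \<Longrightarrow> wf_trm ls (Suc n) (abstr (length ls) n t)"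
  by (induction t) (auto simp: nth_append split: if_splits)

lemma subst_abstr: "wf_trm (ls @ [0]) n t \<Longrightarrow>
    subst (map Var [0..<n] @ [MVar (length ls) []]) (abstr (length ls) n t) = t"
  by (induction t) (auto simp: nth_append map_idI split: if_splits)

lemma abstr_subst: "wf_trm ls (Suc n) t \<Longrightarrow>
    abstr (length ls) n (subst (map Var [0..<n] @ [MVar (length ls) []]) t) = t"
  by (induction t) (auto simp: nth_append map_idI less_Suc_eq)

lemma Comp_MM_eval:
  assumes "g \<in> hom MM ls (map Suc ms)"
  shows "Comp MM (MM_eval ms) (pairing MM (Comp MM g (Pr1 MM ls [0])) (Pr2 MM ls [0])) =
    Arrow (ls @ [0])
      (map (\<lambda>i. subst (map Var [0..<ms ! i] @ [MVar (length ls) []]) (arr g ! i)) [0..<length ms]) ms"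
proof -
  obtain ts where g: "g = Arrow ls ts (map Suc ms)" "length ts = length ms"
     and wf: "\<And>i. i < length ms \<Longrightarrow> wf_trm ls (Suc (ms ! i)) (ts ! i)"
    using assms by (auto simp: MM_hom)
  define p where "p = map (\<lambda>i. MVar i (map Var [0..<ls ! i])) [0..<length ls]"
  have lift: "msubst p (ts ! i) = ts ! i" if "i < length ms" for i
    unfolding p_def by (rule msubst_id[OF wf[OF that]])
  have map_lift: "map (msubst p) ts = ts"
    using lift g by (auto intro!: nth_equalityI)
  have "Comp MM g (Pr1 MM ls [0]) = Arrow (ls @ [0]) ts (map Suc ms)"
    using map_lift by (simp add: g MM_ids p_def)
  moreover have "Comp MM g (Pr1 MM ls [0]) \<in> hom MM (ls @ [0]) (map Suc ms)"
    using MM_comp_hom[OF Pr1_MM assms] .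
  ultimately have "pairing MM (Comp MM g (Pr1 MM ls [0])) (Pr2 MM ls [0]) =
      Arrow (ls @ [0]) (ts @ [MVar (length ls) []]) (map Suc ms @ [0])"
    using pairing_MM[OF _ Pr2_MM] by (force simp: MM_ids)
  then show ?thesis
    using g by (auto simp: MM_eval_def nth_append o_def)
qed

lemma is_exponential_MM: "is_exponential MM [0] ms (map Suc ms) (MM_eval ms)"
  unfolding is_exponential_def
proof (intro conjI ballI)
  show "MM_eval ms \<in> hom MM (Prod MM (map Suc ms) [0]) ms"
    by (auto simp: MM_hom MM_eval_def nth_append less_Suc_eq)
next
  fix ls f assume "f \<in> hom MM (Prod MM ls [0]) ms"
  then obtain ts where f: "f = Arrow (ls @ [0]) ts ms" "length ts = length ms"
     and wf: "\<And>i. i < length ms \<Longrightarrow> wf_trm (ls @ [0]) (ms ! i) (ts ! i)"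
    by (auto simp: MM_hom)
  let ?g = "Arrow ls (map (\<lambda>i. abstr (length ls) (ms ! i) (ts ! i)) [0..<length ms]) (map Suc ms)"
  show "\<exists>!g. g \<in> hom MM ls (map Suc ms) \<and>
     Comp MM (MM_eval ms) (pairing MM (Comp MM g (Pr1 MM ls [0])) (Pr2 MM ls [0])) = f"
  proof (rule ex1I[of _ ?g])
    have g: "?g \<in> hom MM ls (map Suc ms)" using wf by (auto simp: MM_hom wf_abstr)
    then show "?g \<in> hom MM ls (map Suc ms) \<and>
     Comp MM (MM_eval ms) (pairing MM (Comp MM ?g (Pr1 MM ls [0])) (Pr2 MM ls [0])) = f"
      unfolding Comp_MM_eval[OF g] using wf f by (auto intro!: nth_equalityI subst_abstr)
  next
    fix g assume *: "g \<in> hom MM ls (map Suc ms) \<and>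
     Comp MM (MM_eval ms) (pairing MM (Comp MM g (Pr1 MM ls [0])) (Pr2 MM ls [0])) = f"
    then have "ts = map (\<lambda>i. subst (map Var [0..<ms ! i] @ [MVar (length ls) []]) (arr g ! i)) [0..<length ms]"
      using Comp_MM_eval[of g ls ms] f by auto
    moreover obtain us where "g = Arrow ls us (map Suc ms)" "length us = length ms"
     "\<And>i. i < length ms \<Longrightarrow> wf_trm ls (Suc (ms ! i)) (us ! i)"
      using * by (auto simp: MM_hom)
    ultimately show "g = ?g" by (auto intro!: nth_equalityI simp: abstr_subst)
  qed
qed auto


section \<open>Second-order algebraic theories and their set-valued functorial models\<close>

definition second_order_theory ::
  "(nat list, 'm, 'z) cartcat_scheme \<Rightarrow>
   (nat list, (nat list, trm list) arrow, nat list, 'm) func \<Rightarrow> bool" where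
  "second_order_theory TT T \<longleftrightarrow>
     cartesian_category TT \<and>
     Obj TT = Obj MM \<and> (\<forall>x\<in>Obj MM. on_obj T x = x) \<and>
     strict_cartesian_functor MM TT T \<and>
     preserves_exponentiable MM TT T [0]"

lemma second_order_theory_MM:
  "second_order_theory MM \<lparr>on_obj = (\<lambda>x. x), on_arr = (\<lambda>f\<in>Arr MM. f)\<rparr>"
proof -
  have cl: "x \<in> Arr MM" if "x \<in> hom MM a b" for x a b using that by (simp add: hom_def)
  have "is_functor MM MM \<lparr>on_obj = (\<lambda>x. x), on_arr = (\<lambda>f\<in>Arr MM. f)\<rparr>"
    using category_MM cl[OF MM_id_hom] unfolding is_functor_def category_def
    by (auto simp del: MM_sel(6) simp: hom_def)
  moreover have "ev \<in> Arr MM" if "is_exponential MM a b e ev" for a b e ev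
    using that cl unfolding is_exponential_def by blast
  ultimately show ?thesis
    using cl[OF Pr1_MM] cl[OF Pr2_MM]
    by (simp add: second_order_theory_def strict_cartesian_functor_def cartesian_category_MM
        preserves_exponentiable_def)
qed

definition algebraic_translation ::
  "(nat list, 'm, 'z) cartcat_scheme \<Rightarrow>
   (nat list, (nat list, trm list) arrow, nat list, 'm) func \<Rightarrow>
   (nat list, 'n, 'y) cartcat_scheme \<Rightarrow>
   (nat list, (nat list, trm list) arrow, nat list, 'n) func \<Rightarrow>
   (nat list, 'm, nat list, 'n) func \<Rightarrow> bool" where
  "algebraic_translation TT T TT' T' F \<longleftrightarrow> is_functor TT TT' F \<and> T' = func_comp MM F T"

text \<open>The category of sets is taken relative to a universe: its objects are the subsets of the type
  \<open>'u\<close> of cardinality less than \<open>\<kappa>\<close>, an uncountable regular cardinal. Since \<open>\<kappa>\<close> lives on \<open>'u\<close>, every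
  cardinal below \<open>\<kappa>\<close> is represented. A strongly inaccessible \<open>\<kappa>\<close> gives (up to equivalence) the
  sets of a Grothendieck universe; strong inaccessibility itself is not required. All sets over an
  infinite type \<open>'a\<close> are covered (up to equivalence) by \<open>\<kappa> = cardSuc |UNIV :: 'a set|\<close>, with
  \<open>'u = 'a set\<close>.\<close>

unbundle cardinal_syntax

definition set_universe :: "'u rel \<Rightarrow> bool" where
  "set_universe \<kappa> \<longleftrightarrow> Card_order \<kappa> \<and> natLeq <o \<kappa> \<and> regularCard \<kappa>"

lemma set_universe_cardSuc:
  assumes "infinite (UNIV :: 'a set)"
  shows "set_universe (cardSuc |UNIV :: 'a set| )"
proof -
  have c: "Cinfinite |UNIV :: 'a set|"
    using assms card_of_Card_order by (auto simp: cinfinite_def Field_card_of)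
  show ?thesis
    unfolding set_universe_def
  proof (intro conjI)
    show "Card_order (cardSuc |UNIV :: 'a set| )" by (rule cardSuc_Card_order[OF card_of_Card_order])
    show "natLeq <o cardSuc |UNIV :: 'a set|"
      using ordLeq_ordLess_trans[OF natLeq_ordLeq_cinfinite[OF c] cardSuc_greater[OF card_of_Card_order]] .
    show "regularCard (cardSuc |UNIV :: 'a set| )"
      using regularCard_cardSuc[OF c] .
  qed
qed

definition SET :: "'u rel \<Rightarrow> ('u set, ('u set, 'u \<Rightarrow> 'u) arrow) cat" where
  "SET \<kappa> = \<lparr>Obj = {A. |A| <o \<kappa>},
            Arr = {f. |src f| <o \<kappa> \<and> |tgt f| <o \<kappa> \<and> arr f \<in> src f \<rightarrow>\<^sub>E tgt f},
            Dom = src,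
            Cod = tgt,
            Ident = (\<lambda>A. Arrow A (\<lambda>x\<in>A. x) A),
            Comp = (\<lambda>g f. Arrow (src f) (compose (src f) (arr g) (arr f)) (tgt g))\<rparr>"

lemma category_SET: "category (SET \<kappa>)"
  unfolding category_def
proof (intro conjI ballI impI)
  fix f assume f: "f \<in> Arr (SET \<kappa>)"
  show "Comp (SET \<kappa>) f (Ident (SET \<kappa>) (Dom (SET \<kappa>) f)) = f"
    using f by (cases f) (auto simp: SET_def compose_def fun_eq_iff PiE_def extensional_def)
  show "Comp (SET \<kappa>) (Ident (SET \<kappa>) (Cod (SET \<kappa>) f)) f = f"
    using f by (cases f) (auto simp: SET_def compose_def fun_eq_iff PiE_def extensional_def)
next
  fix f g h assume *: "f \<in> Arr (SET \<kappa>)" "g \<in> Arr (SET \<kappa>)" "h \<in> Arr (SET \<kappa>)"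
    "Cod (SET \<kappa>) f = Dom (SET \<kappa>) g" "Cod (SET \<kappa>) g = Dom (SET \<kappa>) h"
  then show "Comp (SET \<kappa>) h (Comp (SET \<kappa>) g f) = Comp (SET \<kappa>) (Comp (SET \<kappa>) h g) f"
    by (auto simp: SET_def intro!: compose_assoc)
qed (auto simp: SET_def hom_def compose_def PiE_def Pi_def)

definition locally_small :: "'u rel \<Rightarrow> ('o, 'm, 'z) cat_scheme \<Rightarrow> bool" where
  "locally_small \<kappa> C \<longleftrightarrow> (\<forall>x\<in>Obj C. \<forall>y\<in>Obj C. |hom C x y| <o \<kappa>)"

definition is_nat_trans ::
  "('o, 'm, 'z) cat_scheme \<Rightarrow> ('p, 'n, 'y) cat_scheme \<Rightarrow>
   ('o, 'm, 'p, 'n) func \<Rightarrow> ('o, 'm, 'p, 'n) func \<Rightarrow> ('o \<Rightarrow> 'n) \<Rightarrow> bool" where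
  "is_nat_trans C D F G \<alpha> \<longleftrightarrow>
     is_functor C D F \<and> is_functor C D G \<and> \<alpha> \<in> extensional (Obj C) \<and>
     (\<forall>x\<in>Obj C. \<alpha> x \<in> hom D (on_obj F x) (on_obj G x)) \<and>
     (\<forall>f\<in>Arr C. Comp D (\<alpha> (Cod C f)) (on_arr F f) = Comp D (on_arr G f) (\<alpha> (Dom C f)))"

definition is_funmod ::
  "('o, 'm, 'z) cat_scheme \<Rightarrow> ('p, 'n, 'y) cat_scheme \<Rightarrow> ('o, 'm, 'p, 'n) func \<Rightarrow> bool" where
  "is_funmod C D S \<longleftrightarrow> is_functor C D S \<and> preserves_finite_products C D S"

definition FunMod ::
  "('o, 'm, 'z) cat_scheme \<Rightarrow> ('p, 'n, 'y) cat_scheme \<Rightarrow>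
   (('o, 'm, 'p, 'n) func, (('o, 'm, 'p, 'n) func, 'o \<Rightarrow> 'n) arrow) cat" where
  "FunMod C D = \<lparr>Obj = {S. is_funmod C D S},
     Arr = {\<alpha>. is_funmod C D (src \<alpha>) \<and> is_funmod C D (tgt \<alpha>) \<and>
              is_nat_trans C D (src \<alpha>) (tgt \<alpha>) (arr \<alpha>)},
     Dom = src,
     Cod = tgt,
     Ident = (\<lambda>S. Arrow S (\<lambda>x\<in>Obj C. Ident D (on_obj S x)) S),
     Comp = (\<lambda>\<beta> \<alpha>. Arrow (src \<alpha>) (\<lambda>x\<in>Obj C. Comp D (arr \<beta> x) (arr \<alpha> x)) (tgt \<beta>))\<rparr>"

text \<open>Restriction along \<open>F : C \<rightarrow> C'\<close>: \<open>S \<mapsto> S \<circ> F\<close> and \<open>\<alpha> \<mapsto> \<alpha>F\<close>.\<close>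

definition algebraic_functor ::
  "('o, 'm, 'z) cat_scheme \<Rightarrow> ('q, 'r, 'x) cat_scheme \<Rightarrow> ('o, 'm, 'q, 'r) func \<Rightarrow>
   ('p, 'n, 'y) cat_scheme \<Rightarrow>
   (('q, 'r, 'p, 'n) func, (('q, 'r, 'p, 'n) func, 'q \<Rightarrow> 'n) arrow,
    ('o, 'm, 'p, 'n) func, (('o, 'm, 'p, 'n) func, 'o \<Rightarrow> 'n) arrow) func" where
  "algebraic_functor C C' F D =
     \<lparr>on_obj = (\<lambda>S\<in>Obj (FunMod C' D). func_comp C S F),
      on_arr = (\<lambda>\<alpha>\<in>Arr (FunMod C' D).
        Arrow (func_comp C (src \<alpha>) F) (\<lambda>x\<in>Obj C. arr \<alpha> (on_obj F x)) (func_comp C (tgt \<alpha>) F))\<rparr>"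

end

theory Submission
  imports Defs "HOL-Library.Countable_Set_Type"
begin

text \<open>The left adjoint is left Kan extension along \<open>F\<close>: it sends \<open>S\<close> to the functor whose value at \<open>c\<close>
  is the set of triples \<open>(a, f : F a \<rightarrow> c, s \<in> S a)\<close> modulo the identifications
  \<open>(a, f \<circ> F h, s) \<sim> (b, f, S h s)\<close> for \<open>h : a \<rightarrow> b\<close>. Since \<open>S\<close> preserves finite products, its category
  of elements has finite products, so this colimit is sifted and the extension preserves finite
  products again. Strictness and the equation \<open>T' = F \<circ> T\<close> make \<open>F\<close> preserve the chosen products, so that
  restriction along \<open>F\<close> is defined. The set of triples is small because \<open>\<kappa>\<close> is regular and uncountable and
  there are countably many objects.\<close>

section \<open>Categories and functors\<close>

text \<open>The value at c is the coend over a of C'(F a, c) x S a. Objects of \<open>SET\<close>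
  are subsets of the fixed type \<open>'u\<close>, so this coend cannot be a set of equivalence
  classes of triples: its classes are named by elements of \<open>'u\<close>, and a map out of it is
  a function on triples that respects the gluing. Test functions with values in \<open>'u\<close>
  are enough, because every map out of the coend used below lands in a subset of \<open>'u\<close>.
  Zigzags of gluings never have to be analysed: equal classes are used only to equate values of a
  test function, and equations between classes come from single gluings. The crux is the
  preservation of binary products. Products in C make sifted colimits explicit: elements over a and
  b are paired over a x b, which yields an inverse of the comparison map L p -> L c x L d. For the
  adjunction it suffices to build one universal arrow S -> L F for each model S; the action of the
  left adjoint on morphisms is then forced.\<close>

lemma hom_in_Arr: "f \<in> hom C a b \<Longrightarrow> f \<in> Arr C"
  by (simp add: hom_def)

lemma hom_Obj:
  assumes "category C" "f \<in> hom C a b"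
  shows "a \<in> Obj C" "b \<in> Obj C"
  using assms by (auto simp: category_def hom_def)

lemma Arr_hom: "f \<in> Arr C \<Longrightarrow> f \<in> hom C (Dom C f) (Cod C f)"
  by (simp add: hom_def)

lemma comp_hom: "category C \<Longrightarrow> f \<in> hom C a b \<Longrightarrow> g \<in> hom C b c \<Longrightarrow> Comp C g f \<in> hom C a c"
  by (auto simp: category_def hom_def)

lemma Comp_assoc:
  "category C \<Longrightarrow> f \<in> hom C a b \<Longrightarrow> g \<in> hom C b c \<Longrightarrow> h \<in> hom C c d \<Longrightarrow>
    Comp C (Comp C h g) f = Comp C h (Comp C g f)"
  by (auto simp: category_def hom_def)

lemma id_hom: "category C \<Longrightarrow> x \<in> Obj C \<Longrightarrow> Ident C x \<in> hom C x x"
  by (simp add: category_def)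

lemma comp_id:
  assumes "category C" "f \<in> hom C a b"
  shows "Comp C f (Ident C a) = f" "Comp C (Ident C b) f = f"
  using assms by (auto simp: category_def hom_def)

lemma categoryI:
  assumes "\<And>f. f \<in> Arr C \<Longrightarrow> Dom C f \<in> Obj C \<and> Cod C f \<in> Obj C"
    and "\<And>x. x \<in> Obj C \<Longrightarrow> Ident C x \<in> hom C x x"
    and "\<And>f g a b c. f \<in> hom C a b \<Longrightarrow> g \<in> hom C b c \<Longrightarrow> Comp C g f \<in> hom C a c"
    and "\<And>f a b. f \<in> hom C a b \<Longrightarrow> Comp C f (Ident C a) = f"
    and "\<And>f a b. f \<in> hom C a b \<Longrightarrow> Comp C (Ident C b) f = f"
    and "\<And>f g h a b c d. f \<in> hom C a b \<Longrightarrow> g \<in> hom C b c \<Longrightarrow> h \<in> hom C c d \<Longrightarrow>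
      Comp C h (Comp C g f) = Comp C (Comp C h g) f"
  shows "category C"
  unfolding category_def
proof (intro conjI ballI impI)
  fix f g assume "f \<in> Arr C" "g \<in> Arr C" "Cod C f = Dom C g"
  then show "Comp C g f \<in> hom C (Dom C f) (Cod C g)"
    by (intro assms(3)[of f _ "Dom C g"]) (simp_all add: hom_def)
next
  fix f g h
  assume "f \<in> Arr C" "g \<in> Arr C" "h \<in> Arr C" "Cod C f = Dom C g" "Cod C g = Dom C h"
  then show "Comp C h (Comp C g f) = Comp C (Comp C h g) f"
    by (intro assms(6)[of f "Dom C f" "Dom C g" g "Dom C h" h "Cod C h"]) (simp_all add: hom_def)
qed (use assms(1,2) assms(4,5)[OF Arr_hom] in simp_all)

lemma functor_category:
  assumes "is_functor C D F"
  shows "category C" "category D"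
  using assms by (auto simp: is_functor_def)

lemma functor_obj: "is_functor C D F \<Longrightarrow> x \<in> Obj C \<Longrightarrow> on_obj F x \<in> Obj D"
  by (auto simp: is_functor_def)

lemma functor_hom:
  "is_functor C D F \<Longrightarrow> f \<in> hom C a b \<Longrightarrow> on_arr F f \<in> hom D (on_obj F a) (on_obj F b)"
  by (auto simp: is_functor_def hom_def)

lemma functor_id:
  "is_functor C D F \<Longrightarrow> x \<in> Obj C \<Longrightarrow> on_arr F (Ident C x) = Ident D (on_obj F x)"
  by (simp add: is_functor_def)

lemma functor_comp:
  "is_functor C D F \<Longrightarrow> f \<in> hom C a b \<Longrightarrow> g \<in> hom C b c \<Longrightarrow>
    on_arr F (Comp C g f) = Comp D (on_arr F g) (on_arr F f)"
  by (auto simp: is_functor_def hom_def)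

lemma is_functorI:
  assumes "category C" "category D"
    and "on_obj F \<in> extensional (Obj C)" "on_arr F \<in> extensional (Arr C)"
    and "\<And>x. x \<in> Obj C \<Longrightarrow> on_obj F x \<in> Obj D"
    and "\<And>f a b. f \<in> hom C a b \<Longrightarrow> on_arr F f \<in> hom D (on_obj F a) (on_obj F b)"
    and "\<And>x. x \<in> Obj C \<Longrightarrow> on_arr F (Ident C x) = Ident D (on_obj F x)"
    and "\<And>f g a b c. f \<in> hom C a b \<Longrightarrow> g \<in> hom C b c \<Longrightarrow>
      on_arr F (Comp C g f) = Comp D (on_arr F g) (on_arr F f)"
  shows "is_functor C D F"
proof -
  have "on_arr F f \<in> Arr D \<and> Dom D (on_arr F f) = on_obj F (Dom C f) \<and>
      Cod D (on_arr F f) = on_obj F (Cod C f)" if "f \<in> Arr C" for f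
    using assms(6)[OF Arr_hom[OF that]] by (simp add: hom_def)
  moreover have "on_arr F (Comp C g f) = Comp D (on_arr F g) (on_arr F f)"
    if "f \<in> Arr C" "g \<in> Arr C" "Cod C f = Dom C g" for f g
    using assms(8) that by (simp add: hom_def)
  ultimately show ?thesis
    unfolding is_functor_def PiE_def Pi_def using assms(1-5,7) by simp
qed

lemma func_comp_sel [simp]:
  "x \<in> Obj C \<Longrightarrow> on_obj (func_comp C G F) x = on_obj G (on_obj F x)"
  "f \<in> Arr C \<Longrightarrow> on_arr (func_comp C G F) f = on_arr G (on_arr F f)"
  by (simp_all add: func_comp_def compose_def)

lemma is_functor_func_comp:
  assumes F: "is_functor C D F" and G: "is_functor D E G"
  shows "is_functor C E (func_comp C G F)"
proof (rule is_functorI)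
  note C = functor_category(1)[OF F]
  show "category C" "category E" using F G functor_category by auto
  show "on_obj (func_comp C G F) \<in> extensional (Obj C)" "on_arr (func_comp C G F) \<in> extensional (Arr C)"
    by (auto simp: func_comp_def compose_def)
  show "on_obj (func_comp C G F) x \<in> Obj E" if "x \<in> Obj C" for x
    using that F G by (simp add: functor_obj)
  show "on_arr (func_comp C G F) f \<in> hom E (on_obj (func_comp C G F) a) (on_obj (func_comp C G F) b)"
    if "f \<in> hom C a b" for f a b
    using that hom_Obj[OF C that] F G by (simp add: functor_hom hom_in_Arr)
  show "on_arr (func_comp C G F) (Ident C x) = Ident E (on_obj (func_comp C G F) x)"
    if "x \<in> Obj C" for x
    using that F G id_hom[OF C that] by (simp add: hom_in_Arr functor_obj functor_id)
  show "on_arr (func_comp C G F) (Comp C g f) =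
      Comp E (on_arr (func_comp C G F) g) (on_arr (func_comp C G F) f)"
    if "f \<in> hom C a b" "g \<in> hom C b c" for f g a b c
  proof -
    have "on_arr (func_comp C G F) (Comp C g f) = on_arr G (on_arr F (Comp C g f))"
      using comp_hom[OF C that] by (simp add: hom_in_Arr)
    also have "\<dots> = Comp E (on_arr G (on_arr F g)) (on_arr G (on_arr F f))"
      by (simp only: functor_comp[OF F that] functor_comp[OF G functor_hom[OF F that(1)] functor_hom[OF F that(2)]])
    finally show ?thesis using that by (simp add: hom_in_Arr)
  qed
qed

text \<open>Universal arrows \<open>\<eta>\<close> : c -> G l, one for each c, already carry the
  whole adjunction. The left adjoint sends h to the unique arrow whose transpose is
  \<open>\<eta>\<close> after h, its functor laws follow from uniqueness, and transposition (G g
  after \<open>\<eta>\<close>) is the natural bijection.\<close>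

lemma has_left_adjointI:
  assumes G: "is_functor D C G"
    and univ: "\<And>c. c \<in> Obj C \<Longrightarrow> \<exists>l\<in>Obj D. \<exists>\<eta>\<in>hom C c (on_obj G l). \<forall>d\<in>Obj D.
      \<forall>f\<in>hom C c (on_obj G d). \<exists>!g. g \<in> hom D l d \<and> Comp C (on_arr G g) \<eta> = f"
  shows "has_left_adjoint D C G"
proof -
  note C = functor_category(2)[OF G] and D = functor_category(1)[OF G]
  obtain l \<eta> where l: "\<And>c. c \<in> Obj C \<Longrightarrow> l c \<in> Obj D"
    and eta: "\<And>c. c \<in> Obj C \<Longrightarrow> \<eta> c \<in> hom C c (on_obj G (l c))"
    and uni: "\<And>c d f. c \<in> Obj C \<Longrightarrow> d \<in> Obj D \<Longrightarrow> f \<in> hom C c (on_obj G d) \<Longrightarrow>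
        \<exists>!g. g \<in> hom D (l c) d \<and> Comp C (on_arr G g) (\<eta> c) = f"
    using univ by metis
  define \<phi> where "\<phi> c d g = Comp C (on_arr G g) (\<eta> c)" for c and d :: 'a and g
  \<comment> \<open>The naturality square of \<open>\<eta>\<close> at h, read as the definition of
    the arrow map.\<close>
  define tr where "tr h = (THE g. g \<in> hom D (l (Dom C h)) (l (Cod C h)) \<and>
      Comp C (on_arr G g) (\<eta> (Dom C h)) = Comp C (\<eta> (Cod C h)) h)" for h
  have tr: "tr h \<in> hom D (l a) (l b)" "Comp C (on_arr G (tr h)) (\<eta> a) = Comp C (\<eta> b) h"
    if h: "h \<in> hom C a b" for h a b
  proof -
    have ab: "a \<in> Obj C" "b \<in> Obj C" using hom_Obj[OF C h] by auto
    have "\<exists>!g. g \<in> hom D (l a) (l b) \<and> Comp C (on_arr G g) (\<eta> a) = Comp C (\<eta> b) h"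
      by (intro uni ab l comp_hom[OF C h eta])
    from theI'[OF this] show "tr h \<in> hom D (l a) (l b)"
        "Comp C (on_arr G (tr h)) (\<eta> a) = Comp C (\<eta> b) h"
      using h by (simp_all add: tr_def hom_def)
  qed
  \<comment> \<open>Transposition commutes with postcomposition. The composition law of
    \<open>L\<close> and the naturality of the bijection both reduce to this.\<close>
  have G_comp: "Comp C (on_arr G (Comp D k g)) (\<eta> c) = Comp C (on_arr G k) (Comp C (on_arr G g) (\<eta> c))"
    if "c \<in> Obj C" "g \<in> hom D (l c) d" "k \<in> hom D d d'" for c g d k d'
    using functor_comp[OF G that(2,3)]
      Comp_assoc[OF C eta[OF that(1)] functor_hom[OF G that(2)] functor_hom[OF G that(3)]]
    by simp
  have tr_eq: "tr h = g" if "h \<in> hom C a b" "g \<in> hom D (l a) (l b)"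
    "Comp C (on_arr G g) (\<eta> a) = Comp C (\<eta> b) h" for h a b g
  proof -
    have ab: "a \<in> Obj C" "b \<in> Obj C" using hom_Obj[OF C that(1)] by auto
    show ?thesis
      using uni[OF ab(1) l[OF ab(2)] comp_hom[OF C that(1) eta[OF ab(2)]]] tr[OF that(1)] that(2,3)
      by auto
  qed
  define L where "L = \<lparr>on_obj = (\<lambda>c\<in>Obj C. l c), on_arr = (\<lambda>h\<in>Arr C. tr h)\<rparr>"
  have L_obj: "on_obj L c = l c" if "c \<in> Obj C" for c using that by (simp add: L_def)
  have L_arr: "on_arr L h = tr h" if "h \<in> hom C a b" for h a b
    using that by (simp add: L_def hom_in_Arr)
  have "is_functor C D L"
  proof (rule is_functorI[OF C D])
    show "on_obj L \<in> extensional (Obj C)" "on_arr L \<in> extensional (Arr C)" by (simp_all add: L_def)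
    show "on_obj L x \<in> Obj D" if "x \<in> Obj C" for x using that by (simp add: L_obj l)
    show "on_arr L f \<in> hom D (on_obj L a) (on_obj L b)" if "f \<in> hom C a b" for f a b
      using tr(1)[OF that] hom_Obj[OF C that] by (simp add: L_arr[OF that] L_obj)
    show "on_arr L (Ident C x) = Ident D (on_obj L x)" if x: "x \<in> Obj C" for x
      unfolding L_arr[OF id_hom[OF C x]] L_obj[OF x]
      by (rule tr_eq[OF id_hom[OF C x] id_hom[OF D l[OF x]]])
        (simp add: functor_id[OF G l[OF x]] comp_id[OF C eta[OF x]])
    show "on_arr L (Comp C g f) = Comp D (on_arr L g) (on_arr L f)"
      if f: "f \<in> hom C a b" and g: "g \<in> hom C b c" for f g a b c
      unfolding L_arr[OF comp_hom[OF C f g]] L_arr[OF f] L_arr[OF g]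
    proof (rule tr_eq[OF comp_hom[OF C f g] comp_hom[OF D tr(1)[OF f] tr(1)[OF g]]])
      have o: "a \<in> Obj C" "b \<in> Obj C" "c \<in> Obj C"
        using hom_Obj[OF C f] hom_Obj[OF C g] by auto
      have "Comp C (on_arr G (Comp D (tr g) (tr f))) (\<eta> a) = Comp C (on_arr G (tr g)) (Comp C (\<eta> b) f)"
        using G_comp[OF o(1) tr(1)[OF f] tr(1)[OF g]] tr(2)[OF f] by simp
      also have "\<dots> = Comp C (Comp C (\<eta> c) g) f"
        using Comp_assoc[OF C f eta[OF o(2)] functor_hom[OF G tr(1)[OF g]]] tr(2)[OF g] by simp
      also have "\<dots> = Comp C (\<eta> c) (Comp C g f)"
        by (rule Comp_assoc[OF C f g eta[OF o(3)]])
      finally show "Comp C (on_arr G (Comp D (tr g) (tr f))) (\<eta> a) = Comp C (\<eta> c) (Comp C g f)" .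
    qed
  qed
  moreover have "bij_betw (\<phi> c d) (hom D (on_obj L c) d) (hom C c (on_obj G d))"
    if c: "c \<in> Obj C" and d: "d \<in> Obj D" for c d
  proof (rule bij_betwI')
    fix x y assume x: "x \<in> hom D (on_obj L c) d" and y: "y \<in> hom D (on_obj L c) d"
    have "\<phi> c d x \<in> hom C c (on_obj G d)"
      using comp_hom[OF C eta[OF c] functor_hom[OF G]] x by (simp add: \<phi>_def L_obj c)
    from uni[OF c d this] show "(\<phi> c d x = \<phi> c d y) = (x = y)"
      using x y unfolding \<phi>_def L_obj[OF c] by metis
  next
    fix x assume "x \<in> hom D (on_obj L c) d"
    then show "\<phi> c d x \<in> hom C c (on_obj G d)"
      using comp_hom[OF C eta[OF c] functor_hom[OF G]] by (simp add: \<phi>_def L_obj c)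
  next
    fix y assume "y \<in> hom C c (on_obj G d)"
    then show "\<exists>x\<in>hom D (on_obj L c) d. y = \<phi> c d x"
      using uni[OF c d] unfolding \<phi>_def L_obj[OF c] by metis
  qed
  moreover have "\<phi> c' d' (Comp D k (Comp D f (on_arr L h))) = Comp C (on_arr G k) (Comp C (\<phi> c d f) h)"
    if o: "c \<in> Obj C" "c' \<in> Obj C" and h: "h \<in> hom C c' c" and k: "k \<in> hom D d d'"
      and f: "f \<in> hom D (on_obj L c) d" for c c' d d' h k f
  proof -
    have f: "f \<in> hom D (l c) d" using f o by (simp add: L_obj)
    have "\<phi> c' d' (Comp D k (Comp D f (on_arr L h))) =
        Comp C (on_arr G k) (Comp C (on_arr G f) (Comp C (on_arr G (tr h)) (\<eta> c')))"
      using G_comp[OF o(2) comp_hom[OF D tr(1)[OF h] f] k] G_comp[OF o(2) tr(1)[OF h] f]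
      by (simp add: \<phi>_def L_arr[OF h])
    then show ?thesis
      using Comp_assoc[OF C h eta[OF o(1)] functor_hom[OF G f]] by (simp add: \<phi>_def tr(2)[OF h])
  qed
  ultimately have "adjunction C D L G \<phi>"
    unfolding adjunction_def using G by auto
  then show ?thesis unfolding has_left_adjoint_def by blast
qed


section \<open>Finite products\<close>

lemma is_productD:
  assumes "is_product C a b p p1 p2"
  shows "a \<in> Obj C" "b \<in> Obj C" "p \<in> Obj C" "p1 \<in> hom C p a" "p2 \<in> hom C p b"
  using assms by (auto simp: is_product_def)

lemma product_pair:
  assumes "category C" "is_product C a b p p1 p2" "f \<in> hom C c a" "g \<in> hom C c b"
  obtains h where "h \<in> hom C c p" "Comp C p1 h = f" "Comp C p2 h = g"
proof -
  have "\<exists>!h. h \<in> hom C c p \<and> Comp C p1 h = f \<and> Comp C p2 h = g"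
    using assms(2-4) hom_Obj(1)[OF assms(1,3)] unfolding is_product_def by blast
  then show ?thesis using that by blast
qed

lemma product_eqI:
  assumes C: "category C" and p: "is_product C a b p p1 p2" and hk: "h \<in> hom C c p" "k \<in> hom C c p"
    and eq: "Comp C p1 h = Comp C p1 k" "Comp C p2 h = Comp C p2 k"
  shows "h = k"
proof -
  have "Comp C p1 h \<in> hom C c a" "Comp C p2 h \<in> hom C c b" "c \<in> Obj C"
    using comp_hom[OF C hk(1)] is_productD[OF p] hom_Obj[OF C hk(1)] by auto
  then have "\<exists>!i. i \<in> hom C c p \<and> Comp C p1 i = Comp C p1 h \<and> Comp C p2 i = Comp C p2 h"
    using p unfolding is_product_def by blast
  then show ?thesis using hk eq by metis
qed

text \<open>Pairing into q is pairing into p followed by j; uniqueness comes back from p because i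
  is invertible.\<close>

lemma is_product_iso:
  assumes C: "category C" and p: "is_product C a b p p1 p2"
    and i: "i \<in> hom C q p" and j: "j \<in> hom C p q"
    and inv: "Comp C j i = Ident C q" "Comp C i j = Ident C p"
  shows "is_product C a b q (Comp C p1 i) (Comp C p2 i)"
  unfolding is_product_def
proof (intro conjI ballI)
  note P = is_productD[OF p]
  show "a \<in> Obj C" "b \<in> Obj C" "q \<in> Obj C" "Comp C p1 i \<in> hom C q a" "Comp C p2 i \<in> hom C q b"
    by (fact P(1,2) hom_Obj(1)[OF C i] comp_hom[OF C i P(4)] comp_hom[OF C i P(5)])+
  fix c f g assume f: "f \<in> hom C c a" and g: "g \<in> hom C c b"
  obtain h where h: "h \<in> hom C c p" "Comp C p1 h = f" "Comp C p2 h = g"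
    using product_pair[OF C p f g] by blast
  have pre: "Comp C (Comp C p1 i) k = Comp C p1 (Comp C i k)"
      "Comp C (Comp C p2 i) k = Comp C p2 (Comp C i k)" if "k \<in> hom C c q" for k
    by (fact Comp_assoc[OF C that i P(4)] Comp_assoc[OF C that i P(5)])+
  show "\<exists>!k. k \<in> hom C c q \<and> Comp C (Comp C p1 i) k = f \<and> Comp C (Comp C p2 i) k = g"
  proof (rule ex1I[of _ "Comp C j h"])
    have "Comp C i (Comp C j h) = h"
      using Comp_assoc[OF C h(1) j i] inv comp_id[OF C h(1)] by simp
    then show "Comp C j h \<in> hom C c q \<and> Comp C (Comp C p1 i) (Comp C j h) = f \<and>
        Comp C (Comp C p2 i) (Comp C j h) = g"
      using comp_hom[OF C h(1) j] pre h by simp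
    fix k assume *: "k \<in> hom C c q \<and> Comp C (Comp C p1 i) k = f \<and> Comp C (Comp C p2 i) k = g"
    then have k: "k \<in> hom C c q" by simp
    have "Comp C i k = h"
      by (rule product_eqI[OF C p comp_hom[OF C k i] h(1)]) (use pre[OF k] h * in auto)
    then show "k = Comp C j h"
      using Comp_assoc[OF C k i j] inv comp_id[OF C k] by simp
  qed
qed

text \<open>A retract of a terminal object is terminal: an arrow k into q equals j after i after k,
  and i after k is determined.\<close>

lemma is_terminal_iso:
  assumes C: "category C" and t: "is_terminal C t"
    and i: "i \<in> hom C q t" and j: "j \<in> hom C t q" and inv: "Comp C j i = Ident C q"
  shows "is_terminal C q"
  unfolding is_terminal_def
proof (intro conjI ballI)
  show "q \<in> Obj C" using hom_Obj[OF C i] by auto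
  fix c assume c: "c \<in> Obj C"
  then obtain f where f: "f \<in> hom C c t" using t unfolding is_terminal_def by blast
  show "\<exists>!f. f \<in> hom C c q"
  proof (rule ex1I[of _ "Comp C j f"])
    show "Comp C j f \<in> hom C c q" by (rule comp_hom[OF C f j])
    fix k assume k: "k \<in> hom C c q"
    then have "Comp C i k = f" using t c f comp_hom[OF C k i] unfolding is_terminal_def by blast
    then show "k = Comp C j f"
      using Comp_assoc[OF C k i j] inv comp_id[OF C k] by simp
  qed
qed

lemma terminal_arrow:
  assumes "is_terminal C t" "c \<in> Obj C"
  obtains f where "f \<in> hom C c t"
  using assms unfolding is_terminal_def by blast

lemma terminal_eqI:
  assumes "category C" "is_terminal C t" "f \<in> hom C c t" "g \<in> hom C c t"
  shows "f = g"
proof -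
  have "\<exists>!f. f \<in> hom C c t"
    using assms(2) hom_Obj(1)[OF assms(1,3)] by (simp add: is_terminal_def)
  then show ?thesis using assms(3,4) by blast
qed

lemma preserves_terminal:
  "preserves_finite_products C D F \<Longrightarrow> is_terminal C t \<Longrightarrow> is_terminal D (on_obj F t)"
  by (simp add: preserves_finite_products_def)

lemma preserves_product:
  "preserves_finite_products C D F \<Longrightarrow> is_product C a b p p1 p2 \<Longrightarrow>
    is_product D (on_obj F a) (on_obj F b) (on_obj F p) (on_arr F p1) (on_arr F p2)"
  by (simp add: preserves_finite_products_def)

text \<open>Preservation is defined for all product cones, but each is isomorphic to the chosen one
  and the functor carries this isomorphism along, so the chosen cones suffice.\<close>

lemma preserves_finite_productsI:
  assumes C: "cartesian_category C" and F: "is_functor C D F"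
    and one: "is_terminal D (on_obj F (One C))"
    and prod: "\<And>a b. a \<in> Obj C \<Longrightarrow> b \<in> Obj C \<Longrightarrow> is_product D (on_obj F a) (on_obj F b)
      (on_obj F (Prod C a b)) (on_arr F (Pr1 C a b)) (on_arr F (Pr2 C a b))"
  shows "preserves_finite_products C D F"
  unfolding preserves_finite_products_def
proof (intro conjI allI impI)
  note cat = functor_category[OF F]
  have one_C: "is_terminal C (One C)" using C by (simp add: cartesian_category_def)
  have F_inv: "Comp D (on_arr F j) (on_arr F i) = Ident D (on_obj F x)"
    if "i \<in> hom C x y" "j \<in> hom C y x" "Comp C j i = Ident C x" for i j x y
    using functor_comp[OF F that(1,2)] functor_id[OF F hom_Obj(1)[OF cat(1) that(1)]] that(3) by simp
  show "is_terminal D (on_obj F t)" if t: "is_terminal C t" for t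
  proof -
    obtain i j where i: "i \<in> hom C t (One C)" and j: "j \<in> hom C (One C) t"
      using t one_C unfolding is_terminal_def by blast
    have "Comp C j i = Ident C t"
      using t comp_hom[OF cat(1) i j] id_hom[OF cat(1), of t] unfolding is_terminal_def by blast
    then show ?thesis
      using is_terminal_iso[OF cat(2) one functor_hom[OF F i] functor_hom[OF F j] F_inv[OF i j]] by simp
  qed
  show "is_product D (on_obj F a) (on_obj F b) (on_obj F p) (on_arr F p1) (on_arr F p2)"
    if p: "is_product C a b p p1 p2" for a b p p1 p2
  proof -
    note P = is_productD[OF p]
    have c: "is_product C a b (Prod C a b) (Pr1 C a b) (Pr2 C a b)"
      using C P by (simp add: cartesian_category_def)
    note Q = is_productD[OF c]
    obtain i where i: "i \<in> hom C p (Prod C a b)" "Comp C (Pr1 C a b) i = p1" "Comp C (Pr2 C a b) i = p2"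
      using product_pair[OF cat(1) c P(4,5)] by blast
    obtain j where j: "j \<in> hom C (Prod C a b) p" "Comp C p1 j = Pr1 C a b" "Comp C p2 j = Pr2 C a b"
      using product_pair[OF cat(1) p Q(4,5)] by blast
    have ji: "Comp C j i = Ident C p"
      using Comp_assoc[OF cat(1) i(1) j(1) P(4)] Comp_assoc[OF cat(1) i(1) j(1) P(5)] i j
        comp_id[OF cat(1) P(4)] comp_id[OF cat(1) P(5)]
      by (intro product_eqI[OF cat(1) p comp_hom[OF cat(1) i(1) j(1)] id_hom[OF cat(1) P(3)]]) auto
    have ij: "Comp C i j = Ident C (Prod C a b)"
      using Comp_assoc[OF cat(1) j(1) i(1) Q(4)] Comp_assoc[OF cat(1) j(1) i(1) Q(5)] i j
        comp_id[OF cat(1) Q(4)] comp_id[OF cat(1) Q(5)]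
      by (intro product_eqI[OF cat(1) c comp_hom[OF cat(1) j(1) i(1)] id_hom[OF cat(1) Q(3)]]) auto
    show ?thesis
      using is_product_iso[OF cat(2) prod[OF P(1,2)] functor_hom[OF F i(1)] functor_hom[OF F j(1)]
          F_inv[OF i(1) j(1) ji] F_inv[OF j(1) i(1) ij]]
        functor_comp[OF F i(1) Q(4)] functor_comp[OF F i(1) Q(5)] i
      by simp
  qed
qed

lemma is_funmodD:
  assumes "is_funmod C D S"
  shows "is_functor C D S" "preserves_finite_products C D S"
  using assms by (simp_all add: is_funmod_def)

lemma is_funmod_func_comp:
  assumes F: "is_functor C D F" "preserves_finite_products C D F" and S: "is_funmod D E S"
  shows "is_funmod C E (func_comp C S F)"
  unfolding is_funmod_def preserves_finite_products_def
proof (intro conjI allI impI)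
  show "is_functor C E (func_comp C S F)"
    by (rule is_functor_func_comp[OF F(1) is_funmodD(1)[OF S]])
  show "is_terminal E (on_obj (func_comp C S F) t)" if "is_terminal C t" for t
  proof -
    have "t \<in> Obj C" using that by (simp add: is_terminal_def)
    then show ?thesis
      using that F(2) is_funmodD(2)[OF S] unfolding preserves_finite_products_def by simp
  qed
  show "is_product E (on_obj (func_comp C S F) a) (on_obj (func_comp C S F) b) (on_obj (func_comp C S F) p)
      (on_arr (func_comp C S F) p1) (on_arr (func_comp C S F) p2)"
    if "is_product C a b p p1 p2" for a b p p1 p2
    using that F(2) is_funmodD(2)[OF S] is_productD[OF that] hom_in_Arr
    unfolding preserves_finite_products_def by (metis func_comp_sel)
qed


section \<open>Categories of functorial models\<close>

lemma nat_transD: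
  assumes "is_nat_trans C D S R t"
  shows "is_functor C D S" "is_functor C D R" "t \<in> extensional (Obj C)"
    and "x \<in> Obj C \<Longrightarrow> t x \<in> hom D (on_obj S x) (on_obj R x)"
    and "f \<in> hom C a b \<Longrightarrow> Comp D (t b) (on_arr S f) = Comp D (on_arr R f) (t a)"
  using assms by (auto simp: is_nat_trans_def hom_def)

lemma is_nat_transI:
  assumes "is_functor C D S" "is_functor C D R" "t \<in> extensional (Obj C)"
    and "\<And>x. x \<in> Obj C \<Longrightarrow> t x \<in> hom D (on_obj S x) (on_obj R x)"
    and "\<And>f a b. f \<in> hom C a b \<Longrightarrow> Comp D (t b) (on_arr S f) = Comp D (on_arr R f) (t a)"
  shows "is_nat_trans C D S R t"
  unfolding is_nat_trans_def using assms(1-4) assms(5)[OF Arr_hom] by simp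

lemma FunMod_sel [simp]:
  "Obj (FunMod C D) = {S. is_funmod C D S}" "Dom (FunMod C D) = src" "Cod (FunMod C D) = tgt"
  "Ident (FunMod C D) S = Arrow S (\<lambda>x\<in>Obj C. Ident D (on_obj S x)) S"
  "Comp (FunMod C D) \<beta> \<alpha> = Arrow (src \<alpha>) (\<lambda>x\<in>Obj C. Comp D (arr \<beta> x) (arr \<alpha> x)) (tgt \<beta>)"
  by (simp_all add: FunMod_def)

lemma FunMod_hom:
  "\<alpha> \<in> hom (FunMod C D) S R \<longleftrightarrow>
    (\<exists>t. \<alpha> = Arrow S t R \<and> is_funmod C D S \<and> is_funmod C D R \<and> is_nat_trans C D S R t)"
  by (cases \<alpha>) (auto simp: hom_def FunMod_def)

lemma is_nat_trans_comp:
  assumes s: "is_nat_trans C D S R s" and t: "is_nat_trans C D R Q t"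
  shows "is_nat_trans C D S Q (\<lambda>x\<in>Obj C. Comp D (t x) (s x))"
proof (rule is_nat_transI)
  note D = functor_category(2)[OF nat_transD(1)[OF s]] and C = functor_category(1)[OF nat_transD(1)[OF s]]
  note S = nat_transD[OF s] and T = nat_transD[OF t]
  show "is_functor C D S" "is_functor C D Q" by (fact S T)+
  show "(\<lambda>x\<in>Obj C. Comp D (t x) (s x)) \<in> extensional (Obj C)" by simp
  show "(\<lambda>x\<in>Obj C. Comp D (t x) (s x)) x \<in> hom D (on_obj S x) (on_obj Q x)" if "x \<in> Obj C" for x
    using comp_hom[OF D S(4) T(4)] that by simp
  show "Comp D ((\<lambda>x\<in>Obj C. Comp D (t x) (s x)) b) (on_arr S f) =
      Comp D (on_arr Q f) ((\<lambda>x\<in>Obj C. Comp D (t x) (s x)) a)" if f: "f \<in> hom C a b" for f a b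
  proof -
    note o = hom_Obj[OF C f]
    have "Comp D (Comp D (t b) (s b)) (on_arr S f) = Comp D (t b) (Comp D (on_arr R f) (s a))"
      using Comp_assoc[OF D functor_hom[OF S(1) f] S(4) T(4)] o S(5)[OF f] by simp
    also have "\<dots> = Comp D (Comp D (on_arr Q f) (t a)) (s a)"
      using Comp_assoc[OF D S(4) functor_hom[OF S(2) f] T(4)] o T(5)[OF f] by simp
    also have "\<dots> = Comp D (on_arr Q f) (Comp D (t a) (s a))"
      using Comp_assoc[OF D S(4) T(4) functor_hom[OF T(2) f]] o by simp
    finally show ?thesis using o by simp
  qed
qed

lemma category_FunMod: "category (FunMod C D)"
proof (rule categoryI)
  fix f assume "f \<in> Arr (FunMod C D)"
  then show "Dom (FunMod C D) f \<in> Obj (FunMod C D) \<and> Cod (FunMod C D) f \<in> Obj (FunMod C D)"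
    by (simp add: FunMod_def)
next
  fix S assume S: "S \<in> Obj (FunMod C D)"
  then have F: "is_functor C D S" by (simp add: is_funmodD)
  note cat = functor_category[OF F]
  have "is_nat_trans C D S S (\<lambda>x\<in>Obj C. Ident D (on_obj S x))"
  proof (rule is_nat_transI[OF F F])
    fix f a b assume f: "f \<in> hom C a b"
    show "Comp D ((\<lambda>x\<in>Obj C. Ident D (on_obj S x)) b) (on_arr S f) =
        Comp D (on_arr S f) ((\<lambda>x\<in>Obj C. Ident D (on_obj S x)) a)"
      using hom_Obj[OF cat(1) f] comp_id[OF cat(2) functor_hom[OF F f]] by simp
  qed (simp_all add: id_hom cat functor_obj[OF F])
  then show "Ident (FunMod C D) S \<in> hom (FunMod C D) S S"
    using S by (simp add: FunMod_hom)
next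
  fix f g S R Q assume "f \<in> hom (FunMod C D) S R" "g \<in> hom (FunMod C D) R Q"
  then show "Comp (FunMod C D) g f \<in> hom (FunMod C D) S Q"
    using is_nat_trans_comp by (fastforce simp: FunMod_hom)
next
  fix f S R assume "f \<in> hom (FunMod C D) S R"
  then obtain t where f: "f = Arrow S t R" and t: "is_nat_trans C D S R t"
    by (auto simp: FunMod_hom)
  note D = functor_category(2)[OF nat_transD(1)[OF t]]
  have "(\<lambda>x\<in>Obj C. Comp D (t x) ((\<lambda>x\<in>Obj C. Ident D (on_obj S x)) x)) = t"
    "(\<lambda>x\<in>Obj C. Comp D ((\<lambda>x\<in>Obj C. Ident D (on_obj R x)) x) (t x)) = t"
    using nat_transD(3)[OF t] comp_id[OF D nat_transD(4)[OF t]]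
    by (auto simp: fun_eq_iff extensional_def)
  then show "Comp (FunMod C D) f (Ident (FunMod C D) S) = f" "Comp (FunMod C D) (Ident (FunMod C D) R) f = f"
    by (simp_all add: f)
next
  fix f g h S R Q P
  assume "f \<in> hom (FunMod C D) S R" "g \<in> hom (FunMod C D) R Q" "h \<in> hom (FunMod C D) Q P"
  then obtain r s t where *:
    "f = Arrow S r R" "is_nat_trans C D S R r" "g = Arrow R s Q" "is_nat_trans C D R Q s"
    "h = Arrow Q t P" "is_nat_trans C D Q P t"
    by (auto simp: FunMod_hom)
  note D = functor_category(2)[OF nat_transD(1)[OF *(2)]]
  have "Comp D (Comp D (t x) (s x)) (r x) = Comp D (t x) (Comp D (s x) (r x))" if "x \<in> Obj C" for x
    by (rule Comp_assoc[OF D nat_transD(4)[OF *(2) that] nat_transD(4)[OF *(4) that]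
          nat_transD(4)[OF *(6) that]])
  then show "Comp (FunMod C D) h (Comp (FunMod C D) g f) = Comp (FunMod C D) (Comp (FunMod C D) h g) f"
    by (auto simp: * fun_eq_iff)
qed

lemma is_nat_trans_restrict:
  assumes F: "is_functor C C' F" and t: "is_nat_trans C' D S R t"
  shows "is_nat_trans C D (func_comp C S F) (func_comp C R F) (\<lambda>x\<in>Obj C. t (on_obj F x))"
proof (rule is_nat_transI)
  note T = nat_transD[OF t] and C = functor_category(1)[OF F]
  show "is_functor C D (func_comp C S F)" "is_functor C D (func_comp C R F)"
    using is_functor_func_comp[OF F] T by auto
  show "(\<lambda>x\<in>Obj C. t (on_obj F x)) x \<in> hom D (on_obj (func_comp C S F) x) (on_obj (func_comp C R F) x)"
    if "x \<in> Obj C" for x using that T(4) functor_obj[OF F] by simp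
  show "Comp D ((\<lambda>x\<in>Obj C. t (on_obj F x)) b) (on_arr (func_comp C S F) f) =
      Comp D (on_arr (func_comp C R F) f) ((\<lambda>x\<in>Obj C. t (on_obj F x)) a)" if f: "f \<in> hom C a b" for f a b
    using hom_Obj[OF C f] hom_in_Arr[OF f] T(5)[OF functor_hom[OF F f]] by simp
qed simp

lemma is_functor_algebraic_functor:
  assumes F: "is_functor C C' F" "preserves_finite_products C C' F"
  shows "is_functor (FunMod C' D) (FunMod C D) (algebraic_functor C C' F D)"
proof (rule is_functorI[OF category_FunMod category_FunMod])
  show "on_obj (algebraic_functor C C' F D) \<in> extensional (Obj (FunMod C' D))"
    "on_arr (algebraic_functor C C' F D) \<in> extensional (Arr (FunMod C' D))"
    by (simp_all add: algebraic_functor_def)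
  show "on_obj (algebraic_functor C C' F D) S \<in> Obj (FunMod C D)" if "S \<in> Obj (FunMod C' D)" for S
    using that is_funmod_func_comp[OF F] by (simp add: algebraic_functor_def)
  show "on_arr (algebraic_functor C C' F D) \<alpha> \<in>
      hom (FunMod C D) (on_obj (algebraic_functor C C' F D) S) (on_obj (algebraic_functor C C' F D) R)"
    if "\<alpha> \<in> hom (FunMod C' D) S R" for \<alpha> S R
    using that hom_in_Arr[OF that] is_nat_trans_restrict[OF F(1)] is_funmod_func_comp[OF F]
    by (auto simp: algebraic_functor_def FunMod_hom)
  show "on_arr (algebraic_functor C C' F D) (Ident (FunMod C' D) S) =
      Ident (FunMod C D) (on_obj (algebraic_functor C C' F D) S)" if S: "S \<in> Obj (FunMod C' D)" for S
    using S hom_in_Arr[OF id_hom[OF category_FunMod S]] functor_obj[OF F(1)]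
    by (auto simp: algebraic_functor_def fun_eq_iff)
  show "on_arr (algebraic_functor C C' F D) (Comp (FunMod C' D) \<beta> \<alpha>) =
      Comp (FunMod C D) (on_arr (algebraic_functor C C' F D) \<beta>) (on_arr (algebraic_functor C C' F D) \<alpha>)"
    if "\<alpha> \<in> hom (FunMod C' D) S R" "\<beta> \<in> hom (FunMod C' D) R Q" for \<alpha> \<beta> S R Q
    using that[THEN hom_in_Arr] hom_in_Arr[OF comp_hom[OF category_FunMod that]] functor_obj[OF F(1)]
    by (auto simp: algebraic_functor_def fun_eq_iff)
qed

section \<open>Finite products of sets\<close>

lemma SET_Obj [simp]: "A \<in> Obj (SET \<kappa>) \<longleftrightarrow> |A| <o \<kappa>"
  by (simp add: SET_def)

lemma SET_hom: "f \<in> hom (SET \<kappa>) A B \<longleftrightarrow>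
    (\<exists>t. f = Arrow A t B \<and> |A| <o \<kappa> \<and> |B| <o \<kappa> \<and> t \<in> A \<rightarrow>\<^sub>E B)"
  by (cases f) (auto simp: hom_def SET_def)

lemma SET_app: "f \<in> hom (SET \<kappa>) A B \<Longrightarrow> x \<in> A \<Longrightarrow> arr f x \<in> B"
  by (auto simp: SET_hom)

lemma SET_comp_app: "f \<in> hom (SET \<kappa>) A B \<Longrightarrow> x \<in> A \<Longrightarrow> arr (Comp (SET \<kappa>) g f) x = arr g (arr f x)"
  by (auto simp: SET_hom) (simp add: SET_def compose_def)

lemma SET_id_app: "x \<in> A \<Longrightarrow> arr (Ident (SET \<kappa>) A) x = x"
  by (simp add: SET_def)

lemma SET_hom_eqI:
  assumes "f \<in> hom (SET \<kappa>) A B" "g \<in> hom (SET \<kappa>) A B" "\<And>x. x \<in> A \<Longrightarrow> arr f x = arr g x"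
  shows "f = g"
  using assms by (auto simp: SET_hom intro: PiE_ext)

lemma SET_homI:
  assumes "|A| <o \<kappa>" "|B| <o \<kappa>" "\<And>x. x \<in> A \<Longrightarrow> t x \<in> B"
  shows "Arrow A (\<lambda>x\<in>A. t x) B \<in> hom (SET \<kappa>) A B"
  using assms by (auto simp: SET_hom)

lemma finite_ordLess: "natLeq <o \<kappa> \<Longrightarrow> finite A \<Longrightarrow> |A| <o \<kappa>"
  using finite_iff_ordLess_natLeq ordLess_transitive by blast

text \<open>Arrows out of a one-point set are elements, so testing on that set forces t to be a
  singleton. The assumption on \<open>\<kappa>\<close> puts finite sets into \<open>SET\<close>;
  \<open>undefined\<close> merely supplies a point of the type.\<close>

lemma is_terminal_SET:
  assumes k: "natLeq <o \<kappa>"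
  shows "is_terminal (SET \<kappa>) (t :: 'u set) \<longleftrightarrow> (\<exists>u. t = {u})"
proof
  assume t: "is_terminal (SET \<kappa>) t"
  let ?pt = "{undefined :: 'u}"
  have small: "|?pt| <o \<kappa>" "|t| <o \<kappa>" using finite_ordLess[OF k] t by (auto simp: is_terminal_def)
  have ex1: "\<exists>!f. f \<in> hom (SET \<kappa>) ?pt t" using t small(1) unfolding is_terminal_def by simp
  then obtain f where "f \<in> hom (SET \<kappa>) ?pt t" by blast
  then have "arr f undefined \<in> t" using SET_app by fastforce
  moreover have "u = v" if "u \<in> t" "v \<in> t" for u v
  proof -
    have "Arrow ?pt (\<lambda>x\<in>?pt. u) t = Arrow ?pt (\<lambda>x\<in>?pt. v) t"
      using ex1 SET_homI[OF small, of "\<lambda>_. u"] SET_homI[OF small, of "\<lambda>_. v"] that by blast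
    then show ?thesis by (auto dest: fun_cong[of _ _ undefined])
  qed
  ultimately show "\<exists>u. t = {u}" by blast
next
  assume "\<exists>u. t = {u}"
  then obtain u where t: "t = {u}" by blast
  have small: "|t| <o \<kappa>" unfolding t by (rule finite_ordLess[OF k]) simp
  show "is_terminal (SET \<kappa>) t"
    unfolding is_terminal_def
  proof (intro conjI ballI ex_ex1I)
    show "t \<in> Obj (SET \<kappa>)" using small by simp
    fix c :: "'u set" assume "c \<in> Obj (SET \<kappa>)"
    then show "\<exists>f. f \<in> hom (SET \<kappa>) c t"
      using SET_homI[of c \<kappa> t "\<lambda>_. u"] small t by auto
    fix f g assume "f \<in> hom (SET \<kappa>) c t" "g \<in> hom (SET \<kappa>) c t"
    then show "f = g" using t SET_app by (intro SET_hom_eqI[of f \<kappa> c t g]) fastforce+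
  qed
qed

text \<open>In one direction elements are tested as arrows out of a one-point set; in the other the
  mediating arrow is chosen pointwise. Products are used for \<open>S\<close> and verified for
  \<open>L\<close> in this elementwise form.\<close>

lemma is_product_SET:
  assumes k: "natLeq <o \<kappa>" and p: "p1 \<in> hom (SET \<kappa>) P A" "p2 \<in> hom (SET \<kappa>) P (B :: 'u set)"
  shows "is_product (SET \<kappa>) A B P p1 p2 \<longleftrightarrow>
    (\<forall>a\<in>A. \<forall>b\<in>B. \<exists>!z. z \<in> P \<and> arr p1 z = a \<and> arr p2 z = b)"
proof
  have small: "|A| <o \<kappa>" "|B| <o \<kappa>" "|P| <o \<kappa>" using p by (auto simp: SET_hom)
  let ?pt = "{undefined :: 'u}"
  have pt: "|?pt| <o \<kappa>" by (rule finite_ordLess[OF k]) simp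
  have const: "Arrow ?pt (\<lambda>x\<in>?pt. u) X \<in> hom (SET \<kappa>) ?pt X" if "u \<in> X" "|X| <o \<kappa>" for u X
    using SET_homI[OF pt that(2), of "\<lambda>_. u"] that(1) by simp
  show "\<forall>a\<in>A. \<forall>b\<in>B. \<exists>!z. z \<in> P \<and> arr p1 z = a \<and> arr p2 z = b"
    if prod: "is_product (SET \<kappa>) A B P p1 p2"
  proof (intro ballI ex_ex1I)
    fix a b assume ab: "a \<in> A" "b \<in> B"
    obtain h where h: "h \<in> hom (SET \<kappa>) ?pt P" "Comp (SET \<kappa>) p1 h = Arrow ?pt (\<lambda>x\<in>?pt. a) A"
        "Comp (SET \<kappa>) p2 h = Arrow ?pt (\<lambda>x\<in>?pt. b) B"
      using product_pair[OF category_SET prod const[OF ab(1) small(1)] const[OF ab(2) small(2)]] by blast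
    have "arr p1 (arr h undefined) = a" "arr p2 (arr h undefined) = b"
      using SET_comp_app[OF h(1), of undefined] h(2,3) by (metis arrow.sel(2) insertI1 restrict_apply')+
    then show "\<exists>z. z \<in> P \<and> arr p1 z = a \<and> arr p2 z = b"
      using SET_app[OF h(1)] by blast
    fix z z' assume z: "z \<in> P \<and> arr p1 z = a \<and> arr p2 z = b"
      and z': "z' \<in> P \<and> arr p1 z' = a \<and> arr p2 z' = b"
    have c: "Arrow ?pt (\<lambda>x\<in>?pt. z) P \<in> hom (SET \<kappa>) ?pt P"
        "Arrow ?pt (\<lambda>x\<in>?pt. z') P \<in> hom (SET \<kappa>) ?pt P"
      using const z z' small by auto
    have "Comp (SET \<kappa>) p (Arrow ?pt (\<lambda>x\<in>?pt. z) P) = Comp (SET \<kappa>) p (Arrow ?pt (\<lambda>x\<in>?pt. z') P)"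
      if "p \<in> hom (SET \<kappa>) P X" "arr p z = arr p z'" for p X
      using that comp_hom[OF category_SET c(1) that(1)] comp_hom[OF category_SET c(2) that(1)]
      by (intro SET_hom_eqI[of _ \<kappa> ?pt X]) (auto simp: SET_comp_app[OF c(1)] SET_comp_app[OF c(2)])
    then have "Arrow ?pt (\<lambda>x\<in>?pt. z) P = Arrow ?pt (\<lambda>x\<in>?pt. z') P"
      using p z z' by (intro product_eqI[OF category_SET prod c]) auto
    then show "z = z'" by (auto dest: fun_cong[of _ _ undefined])
  qed
  show "is_product (SET \<kappa>) A B P p1 p2"
    if ex1: "\<forall>a\<in>A. \<forall>b\<in>B. \<exists>!z. z \<in> P \<and> arr p1 z = a \<and> arr p2 z = b"
    unfolding is_product_def
  proof (intro conjI ballI ex_ex1I)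
    show "A \<in> Obj (SET \<kappa>)" "B \<in> Obj (SET \<kappa>)" "P \<in> Obj (SET \<kappa>)" using small by simp_all
    show "p1 \<in> hom (SET \<kappa>) P A" "p2 \<in> hom (SET \<kappa>) P B" by (fact p)+
    fix c f g assume "c \<in> Obj (SET \<kappa>)" and f: "f \<in> hom (SET \<kappa>) c A" and g: "g \<in> hom (SET \<kappa>) c B"
    then have c: "|c| <o \<kappa>" by simp
    have "\<forall>x\<in>c. \<exists>z. z \<in> P \<and> arr p1 z = arr f x \<and> arr p2 z = arr g x"
      using ex1 SET_app[OF f] SET_app[OF g] by blast
    then obtain t where t: "\<And>x. x \<in> c \<Longrightarrow> t x \<in> P \<and> arr p1 (t x) = arr f x \<and> arr p2 (t x) = arr g x"
      by metis
    define h where "h = Arrow c (\<lambda>x\<in>c. t x) P"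
    have h: "h \<in> hom (SET \<kappa>) c P" unfolding h_def using c small(3) t by (intro SET_homI) auto
    have "Comp (SET \<kappa>) p1 h = f" "Comp (SET \<kappa>) p2 h = g"
      using t SET_comp_app[OF h]
      by (auto simp: h_def intro!: SET_hom_eqI[OF _ f] SET_hom_eqI[OF _ g] comp_hom[OF category_SET h[unfolded h_def]] p)
    with h show "\<exists>h. h \<in> hom (SET \<kappa>) c P \<and> Comp (SET \<kappa>) p1 h = f \<and> Comp (SET \<kappa>) p2 h = g"
      by blast
    fix h k
    assume h: "h \<in> hom (SET \<kappa>) c P \<and> Comp (SET \<kappa>) p1 h = f \<and> Comp (SET \<kappa>) p2 h = g"
      and k: "k \<in> hom (SET \<kappa>) c P \<and> Comp (SET \<kappa>) p1 k = f \<and> Comp (SET \<kappa>) p2 k = g"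
    show "h = k"
    proof (rule SET_hom_eqI)
      show "h \<in> hom (SET \<kappa>) c P" "k \<in> hom (SET \<kappa>) c P" using h k by auto
      fix x assume x: "x \<in> c"
      have "arr h x \<in> P \<and> arr p1 (arr h x) = arr f x \<and> arr p2 (arr h x) = arr g x"
        "arr k x \<in> P \<and> arr p1 (arr k x) = arr f x \<and> arr p2 (arr k x) = arr g x"
        using h k x SET_app SET_comp_app by metis+
      then show "arr h x = arr k x" using ex1 SET_app[OF f x] SET_app[OF g x] by blast
    qed
  qed
qed

section \<open>Left Kan extension of a functorial model\<close>

text \<open>One model \<open>S\<close> is fixed, since universal arrows are built one model at a
  time. The size bounds concern the objects of \<open>C\<close> and the hom sets of
  \<open>C'\<close>, which together with the values of \<open>S\<close> index the triples.\<close>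

locale kan_extension =
  fixes \<kappa> :: "'u rel"
    and C :: "('o, 'm, 'z) cartcat_scheme" and C' :: "('p, 'n, 'y) cat_scheme"
    and F :: "('o, 'm, 'p, 'n) func"
    and S :: "('o, 'm, 'u set, ('u set, 'u \<Rightarrow> 'u) arrow) func"
  assumes universe: "set_universe \<kappa>"
    and cartesian: "cartesian_category C"
    and F: "is_functor C C' F"
    and F_prod: "preserves_finite_products C C' F"
    and Obj_small: "|Obj C| <o \<kappa>"
    and hom_small: "locally_small \<kappa> C'"
    and S: "is_funmod C (SET \<kappa>) S"
begin

lemmas C = functor_category(1)[OF F] and C' = functor_category(2)[OF F]
  and S_functor = is_funmodD(1)[OF S] and S_prod = is_funmodD(2)[OF S]

lemma infinite_universe: "natLeq <o \<kappa>"
  using universe by (simp add: set_universe_def)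

abbreviation act :: "'m \<Rightarrow> 'u \<Rightarrow> 'u" where
  "act h \<equiv> arr (on_arr S h)"

lemma act_in: "h \<in> hom C a b \<Longrightarrow> s \<in> on_obj S a \<Longrightarrow> act h s \<in> on_obj S b"
  using SET_app[OF functor_hom[OF S_functor]] .

lemma act_comp:
  "h \<in> hom C a b \<Longrightarrow> k \<in> hom C b c \<Longrightarrow> s \<in> on_obj S a \<Longrightarrow> act (Comp C k h) s = act k (act h s)"
  using functor_comp[OF S_functor] SET_comp_app[OF functor_hom[OF S_functor]] by simp

lemma act_id: "a \<in> Obj C \<Longrightarrow> s \<in> on_obj S a \<Longrightarrow> act (Ident C a) s = s"
  using functor_id[OF S_functor] SET_id_app by simp

section \<open>The gluing quotient of triples, realised inside \<open>'u\<close>\<close>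

definition elems :: "'p \<Rightarrow> ('o \<times> 'n \<times> 'u) set" where
  "elems c = {(a, f, s). a \<in> Obj C \<and> f \<in> hom C' (on_obj F a) c \<and> s \<in> on_obj S a}"

text \<open>Two triples are identified iff all compatible functions into \<open>'u\<close> agree on them. There are fewer
  than \<open>\<kappa>\<close> triples, so the quotient embeds into \<open>'u\<close>, and this is the equivalence relation
  generated by the gluing equations.\<close>

definition compatible :: "'p \<Rightarrow> ('o \<times> 'n \<times> 'u \<Rightarrow> 'u) \<Rightarrow> bool" where
  "compatible c \<Phi> \<longleftrightarrow> (\<forall>a b. \<forall>h\<in>hom C a b. \<forall>f\<in>hom C' (on_obj F b) c. \<forall>s\<in>on_obj S a.
     \<Phi> (a, Comp C' f (on_arr F h), s) = \<Phi> (b, f, act h s))"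

lemma elemsI: "f \<in> hom C' (on_obj F a) c \<Longrightarrow> a \<in> Obj C \<Longrightarrow> s \<in> on_obj S a \<Longrightarrow> (a, f, s) \<in> elems c"
  by (simp add: elems_def)

lemma elemsE:
  assumes "x \<in> elems c"
  obtains a f s where "x = (a, f, s)" "a \<in> Obj C" "f \<in> hom C' (on_obj F a) c" "s \<in> on_obj S a"
  using assms by (auto simp: elems_def)

lemma elems_small:
  assumes "c \<in> Obj C'"
  shows "|elems c| <o \<kappa>"
proof -
  have "Cinfinite \<kappa>" "regularCard \<kappa>"
    using universe cinfinite_mono[OF ordLess_imp_ordLeq natLeq_cinfinite]
    unfolding set_universe_def by blast+
  \<comment> \<open>An infinite regular cardinal is stable: a union of fewer than
    \<open>\<kappa>\<close> sets, each smaller than \<open>\<kappa>\<close>, is smaller than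
    \<open>\<kappa>\<close>. Below this is applied twice, over objects and over arrows.\<close>
  then have stable: "stable \<kappa>" unfolding cinfinite_def by (intro regularCard_stable) blast+
  have "|(\<lambda>s. (a, f, s)) ` on_obj S a| <o \<kappa>" if a: "a \<in> Obj C" for a f
    using functor_obj[OF S_functor a] by (simp add: ordLeq_ordLess_trans[OF card_of_image])
  moreover have "|hom C' (on_obj F a) c| <o \<kappa>" if a: "a \<in> Obj C" for a
    using hom_small functor_obj[OF F a] assms unfolding locally_small_def by blast
  ultimately have "|\<Union>a\<in>Obj C. \<Union>f\<in>hom C' (on_obj F a) c. (\<lambda>s. (a, f, s)) ` on_obj S a| <o \<kappa>"
    by (intro stable_UNION[OF stable] Obj_small)
  moreover have "elems c = (\<Union>a\<in>Obj C. \<Union>f\<in>hom C' (on_obj F a) c. (\<lambda>s. (a, f, s)) ` on_obj S a)"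
    by (auto simp: elems_def)
  ultimately show ?thesis by simp
qed

text \<open>A class gets its name by applying an injection of the triples into \<open>'u\<close> to
  a representative that depends only on the class.\<close>

lemma ex_class:
  assumes "c \<in> Obj C'"
  shows "\<exists>q :: _ \<Rightarrow> 'u. \<forall>x\<in>elems c. \<forall>y\<in>elems c. q x = q y \<longleftrightarrow> (\<forall>\<Phi>. compatible c \<Phi> \<longrightarrow> \<Phi> x = \<Phi> y)"
proof -
  define R where "R x y \<longleftrightarrow> (\<forall>\<Phi>. compatible c \<Phi> \<longrightarrow> \<Phi> x = \<Phi> y)" for x y
  have "|elems c| \<le>o |UNIV :: 'u set|"
  proof -
    have "\<kappa> =o |Field \<kappa>|"
      using universe card_of_Field_ordIso ordIso_symmetric unfolding set_universe_def by blast
    moreover have "|Field \<kappa>| \<le>o |UNIV :: 'u set|" by (rule card_of_mono1) simp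
    ultimately have "\<kappa> \<le>o |UNIV :: 'u set|" by (rule ordIso_ordLeq_trans)
    with ordLess_imp_ordLeq[OF elems_small[OF assms]] show ?thesis by (rule ordLeq_transitive)
  qed
  then obtain j :: "_ \<Rightarrow> 'u" where j: "inj_on j (elems c)"
    by (auto simp: card_of_ordLeq[symmetric])
  define r where "r x = (SOME y. y \<in> elems c \<and> R x y)" for x
  have r: "r x \<in> elems c \<and> R x (r x)" if "x \<in> elems c" for x
    unfolding r_def by (rule someI[of _ x]) (simp add: that R_def)
  have "j (r x) = j (r y) \<longleftrightarrow> R x y" if xy: "x \<in> elems c" "y \<in> elems c" for x y
  proof
    assume "j (r x) = j (r y)"
    then have "r x = r y" by (rule inj_onD[OF j]) (simp_all add: r xy)
    then have "R x (r x)" "R y (r x)" using r[OF xy(1)] r[OF xy(2)] by simp_all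
    then show "R x y" unfolding R_def by metis
  next
    assume "R x y"
    \<comment> \<open>Equality as predicates, so that the choice operator in \<open>r\<close>
      receives the same argument and picks the same triple for x and y.\<close>
    then have "R x = R y" unfolding R_def by (intro ext) metis
    then show "j (r x) = j (r y)" by (simp add: r_def)
  qed
  then show ?thesis unfolding R_def by (intro exI[of _ "\<lambda>x. j (r x)"] ballI)
qed

text \<open>A separate choice for each c: names of classes over different objects are unrelated, and
  only equalities at the same c carry meaning.\<close>

definition cls :: "'p \<Rightarrow> 'o \<times> 'n \<times> 'u \<Rightarrow> 'u" where
  "cls c = (SOME q. \<forall>x\<in>elems c. \<forall>y\<in>elems c. q x = q y \<longleftrightarrow> (\<forall>\<Phi>. compatible c \<Phi> \<longrightarrow> \<Phi> x = \<Phi> y))"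

lemma cls_eq_iff:
  assumes "c \<in> Obj C'" "x \<in> elems c" "y \<in> elems c"
  shows "cls c x = cls c y \<longleftrightarrow> (\<forall>\<Phi>. compatible c \<Phi> \<longrightarrow> \<Phi> x = \<Phi> y)"
  using someI_ex[OF ex_class[OF assms(1)], folded cls_def] assms(2,3) by blast

text \<open>Every function that \<open>compatible\<close> admits satisfies this equation, so no test
  function separates the two triples. The later identifications of classes rest on it.\<close>

lemma cls_glue:
  assumes h: "h \<in> hom C a b" and f: "f \<in> hom C' (on_obj F b) c" and s: "s \<in> on_obj S a"
  shows "cls c (a, Comp C' f (on_arr F h), s) = cls c (b, f, act h s)"
proof -
  have "(a, Comp C' f (on_arr F h), s) \<in> elems c" "(b, f, act h s) \<in> elems c"
    using comp_hom[OF C' functor_hom[OF F h] f] f s act_in[OF h s] hom_Obj[OF C h] by (auto intro: elemsI)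
  then show ?thesis
    using cls_eq_iff[OF hom_Obj(2)[OF C' f]] h f s by (auto simp: compatible_def)
qed

text \<open>The function induced by \<open>\<Phi>\<close> on classes, evaluated at an arbitrary
  representative; independence of the representative for compatible \<open>\<Phi>\<close> is
  \<open>lift_cls\<close>.\<close>

definition lift :: "'p \<Rightarrow> ('o \<times> 'n \<times> 'u \<Rightarrow> 'u) \<Rightarrow> 'u \<Rightarrow> 'u" where
  "lift c \<Phi> z = \<Phi> (inv_into (elems c) (cls c) z)"

lemma lift_cls:
  assumes "c \<in> Obj C'" "compatible c \<Phi>" "x \<in> elems c"
  shows "lift c \<Phi> (cls c x) = \<Phi> x"
proof -
  let ?y = "inv_into (elems c) (cls c) (cls c x)"
  have x: "cls c x \<in> cls c ` elems c" using assms(3) by simp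
  have "cls c ?y = cls c x" by (rule f_inv_into_f[OF x])
  then show ?thesis
    using cls_eq_iff[OF assms(1) inv_into_into[OF x] assms(3)] assms(2) by (simp add: lift_def)
qed

section \<open>The extension as a functor: postcomposition on classes\<close>

definition push :: "'n \<Rightarrow> 'o \<times> 'n \<times> 'u \<Rightarrow> 'o \<times> 'n \<times> 'u" where
  "push k = (\<lambda>(a, f, s). (a, Comp C' k f, s))"

lemma push_simp [simp]: "push k (a, f, s) = (a, Comp C' k f, s)"
  by (simp add: push_def)

lemma push_elems: "k \<in> hom C' c d \<Longrightarrow> x \<in> elems c \<Longrightarrow> push k x \<in> elems d"
  using comp_hom[OF C'] by (auto simp: elems_def)

lemma push_id: "x \<in> elems c \<Longrightarrow> push (Ident C' c) x = x"
  by (elim elemsE) (simp add: comp_id(2)[OF C'])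

lemma push_comp:
  "f \<in> hom C' b c \<Longrightarrow> g \<in> hom C' c d \<Longrightarrow> x \<in> elems b \<Longrightarrow>
    push (Comp C' g f) x = push g (push f x)"
  by (elim elemsE) (simp add: Comp_assoc[OF C'])

text \<open>Postcomposition with k acts at the far end of f from the gluing arrow, so by
  associativity a gluing over c becomes a gluing over d.\<close>

lemma compatible_push:
  assumes k: "k \<in> hom C' c d"
  shows "compatible c (\<lambda>x. cls d (push k x))"
  unfolding compatible_def
proof (intro allI ballI)
  fix a b h f s assume h: "h \<in> hom C a b" and f: "f \<in> hom C' (on_obj F b) c" and s: "s \<in> on_obj S a"
  show "cls d (push k (a, Comp C' f (on_arr F h), s)) = cls d (push k (b, f, act h s))"
    using cls_glue[OF h comp_hom[OF C' f k] s] Comp_assoc[OF C' functor_hom[OF F h] f k] by simp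
qed

definition L_set :: "'p \<Rightarrow> 'u set" where
  "L_set c = cls c ` elems c"

definition L :: "('p, 'n, 'u set, ('u set, 'u \<Rightarrow> 'u) arrow) func" where
  "L = \<lparr>on_obj = (\<lambda>c\<in>Obj C'. L_set c),
        on_arr = (\<lambda>k\<in>Arr C'. Arrow (L_set (Dom C' k))
          (\<lambda>z\<in>L_set (Dom C' k). lift (Dom C' k) (\<lambda>x. cls (Cod C' k) (push k x)) z) (L_set (Cod C' k)))\<rparr>"

lemma L_obj: "c \<in> Obj C' \<Longrightarrow> on_obj L c = L_set c"
  by (simp add: L_def)

lemma L_set_small: "c \<in> Obj C' \<Longrightarrow> |L_set c| <o \<kappa>"
  unfolding L_set_def using ordLeq_ordLess_trans[OF card_of_image elems_small] .

lemma lift_L_set: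
  assumes "c \<in> Obj C'" "compatible c \<Phi>" "\<And>x. x \<in> elems c \<Longrightarrow> \<Phi> x \<in> X" "z \<in> L_set c"
  shows "lift c \<Phi> z \<in> X"
  using assms lift_cls[OF assms(1,2)] by (auto simp: L_set_def)

lemma L_arr_hom:
  assumes k: "k \<in> hom C' c d"
  shows "on_arr L k \<in> hom (SET \<kappa>) (L_set c) (L_set d)"
proof -
  have "on_arr L k = Arrow (L_set c) (\<lambda>z\<in>L_set c. lift c (\<lambda>x. cls d (push k x)) z) (L_set d)"
    using k by (auto simp: L_def hom_def)
  then show ?thesis
    using SET_homI[OF L_set_small L_set_small, of c d "lift c (\<lambda>x. cls d (push k x))"]
      lift_L_set[OF _ compatible_push[OF k]] push_elems[OF k] hom_Obj[OF C' k]
    by (simp add: L_set_def)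
qed

text \<open>The computation rule on representatives; later arguments about \<open>L\<close> go
  through it and not through \<open>lift\<close>.\<close>

lemma L_arr_cls:
  assumes k: "k \<in> hom C' c d" and x: "x \<in> elems c"
  shows "arr (on_arr L k) (cls c x) = cls d (push k x)"
proof -
  have "arr (on_arr L k) (cls c x) = lift c (\<lambda>x. cls d (push k x)) (cls c x)"
    using k x by (auto simp: L_def hom_def L_set_def)
  then show ?thesis
    using lift_cls[OF hom_Obj(1)[OF C' k] compatible_push[OF k] x] by simp
qed

lemma L_functor: "is_functor C' (SET \<kappa>) L"
proof (rule is_functorI[OF C' category_SET])
  show "on_obj L \<in> extensional (Obj C')" "on_arr L \<in> extensional (Arr C')"
    by (simp_all add: L_def)
  show "on_obj L c \<in> Obj (SET \<kappa>)" if "c \<in> Obj C'" for c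
    using L_set_small[OF that] by (simp add: L_obj that)
  show "on_arr L k \<in> hom (SET \<kappa>) (on_obj L c) (on_obj L d)" if "k \<in> hom C' c d" for k c d
    using L_arr_hom[OF that] hom_Obj[OF C' that] by (simp add: L_obj)
  show "on_arr L (Ident C' c) = Ident (SET \<kappa>) (on_obj L c)" if c: "c \<in> Obj C'" for c
    unfolding L_obj[OF c]
  proof (rule SET_hom_eqI[OF L_arr_hom[OF id_hom[OF C' c]] id_hom[OF category_SET]])
    show "L_set c \<in> Obj (SET \<kappa>)" using L_set_small[OF c] by simp
    fix z assume "z \<in> L_set c"
    then obtain x where x: "z = cls c x" "x \<in> elems c" by (auto simp: L_set_def)
    show "arr (on_arr L (Ident C' c)) z = arr (Ident (SET \<kappa>) (L_set c)) z"
      using x L_arr_cls[OF id_hom[OF C' c] x(2)] SET_id_app[of z "L_set c"] \<open>z \<in> L_set c\<close>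
        push_id[OF x(2)] by simp
  qed
  show "on_arr L (Comp C' g f) = Comp (SET \<kappa>) (on_arr L g) (on_arr L f)"
    if f: "f \<in> hom C' a b" and g: "g \<in> hom C' b c" for f g a b c
  proof (rule SET_hom_eqI[OF L_arr_hom[OF comp_hom[OF C' f g]]
        comp_hom[OF category_SET L_arr_hom[OF f] L_arr_hom[OF g]]])
    fix z assume z: "z \<in> L_set a"
    then obtain x where x: "z = cls a x" "x \<in> elems a" by (auto simp: L_set_def)
    show "arr (on_arr L (Comp C' g f)) z = arr (Comp (SET \<kappa>) (on_arr L g) (on_arr L f)) z"
      using SET_comp_app[OF L_arr_hom[OF f] z, of "on_arr L g"] x(1)
        L_arr_cls[OF comp_hom[OF C' f g] x(2)] L_arr_cls[OF f x(2)] L_arr_cls[OF g push_elems[OF f x(2)]]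
        push_comp[OF f g x(2)]
      by simp
  qed
qed

section \<open>Preservation of finite products by the extension\<close>

lemma L_terminal:
  assumes t: "is_terminal C' t"
  shows "is_terminal (SET \<kappa>) (on_obj L t)"
proof -
  have One: "is_terminal C (One C)" using cartesian by (simp add: cartesian_category_def)
  have o: "t \<in> Obj C'" "One C \<in> Obj C" using t One by (simp_all add: is_terminal_def)
  obtain u where u: "on_obj S (One C) = {u}"
    using preserves_terminal[OF S_prod One] is_terminal_SET[OF infinite_universe] by blast
  obtain g where g: "g \<in> hom C' (on_obj F (One C)) t"
    using terminal_arrow[OF t functor_obj[OF F o(2)]] .
  have "cls t x = cls t (One C, g, u)" if "x \<in> elems t" for x
    using that
  proof (rule elemsE)
    fix a f s assume x: "x = (a, f, s)" "a \<in> Obj C" "f \<in> hom C' (on_obj F a) t" "s \<in> on_obj S a"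
    obtain h where h: "h \<in> hom C a (One C)" using terminal_arrow[OF One x(2)] .
    \<comment> \<open>Both sides are arrows into the terminal object t. Hence every triple over t is
      glued along h to the single triple \<open>(One C, g, u)\<close>, since \<open>u\<close> is the
      only element of S at \<open>One C\<close>.\<close>
    have "f = Comp C' g (on_arr F h)"
      by (rule terminal_eqI[OF C' t x(3) comp_hom[OF C' functor_hom[OF F h] g]])
    then show "cls t x = cls t (One C, g, u)"
      using cls_glue[OF h g x(4)] act_in[OF h x(4)] u x(1) by simp
  qed
  moreover have "(One C, g, u) \<in> elems t" using g u o by (simp add: elems_def)
  ultimately have "on_obj L t = {cls t (One C, g, u)}"
    unfolding L_obj[OF o(1)] L_set_def by blast
  then show ?thesis using is_terminal_SET[OF infinite_universe] by blast
qed

lemma Prod_product: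
  "a \<in> Obj C \<Longrightarrow> b \<in> Obj C \<Longrightarrow> is_product C a b (Prod C a b) (Pr1 C a b) (Pr2 C a b)"
  using cartesian by (simp add: cartesian_category_def)

lemma F_comp_assoc:
  "h \<in> hom C a b \<Longrightarrow> k \<in> hom C b e \<Longrightarrow> f \<in> hom C' (on_obj F e) c \<Longrightarrow>
    Comp C' (Comp C' f (on_arr F k)) (on_arr F h) = Comp C' f (on_arr F (Comp C k h))"
  using Comp_assoc[OF C' functor_hom[OF F] functor_hom[OF F]] functor_comp[OF F] by simp

lemma S_pair_ex1:
  assumes "a \<in> Obj C" "b \<in> Obj C" "s \<in> on_obj S a" "t \<in> on_obj S b"
  shows "\<exists>!z. z \<in> on_obj S (Prod C a b) \<and> act (Pr1 C a b) z = s \<and> act (Pr2 C a b) z = t"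
proof -
  note p = Prod_product[OF assms(1,2)]
  have "is_product (SET \<kappa>) (on_obj S a) (on_obj S b) (on_obj S (Prod C a b))
      (on_arr S (Pr1 C a b)) (on_arr S (Pr2 C a b))"
    by (rule preserves_product[OF S_prod p])
  then show ?thesis
    using is_product_SET[OF infinite_universe functor_hom[OF S_functor is_productD(4)[OF p]]
        functor_hom[OF S_functor is_productD(5)[OF p]]] assms(3,4) by simp
qed

definition spair :: "'o \<Rightarrow> 'o \<Rightarrow> 'u \<Rightarrow> 'u \<Rightarrow> 'u" where
  "spair a b s t = (THE z. z \<in> on_obj S (Prod C a b) \<and> act (Pr1 C a b) z = s \<and> act (Pr2 C a b) z = t)"

lemma spair:
  assumes "a \<in> Obj C" "b \<in> Obj C" "s \<in> on_obj S a" "t \<in> on_obj S b"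
  shows "spair a b s t \<in> on_obj S (Prod C a b)"
    "act (Pr1 C a b) (spair a b s t) = s" "act (Pr2 C a b) (spair a b s t) = t"
  using theI'[OF S_pair_ex1[OF assms]] by (simp_all add: spair_def)

lemma spair_eqI:
  assumes "a \<in> Obj C" "b \<in> Obj C" "z \<in> on_obj S (Prod C a b)"
    and "act (Pr1 C a b) z = s" "act (Pr2 C a b) z = t"
  shows "spair a b s t = z"
proof -
  note p = is_productD[OF Prod_product[OF assms(1,2)]]
  have "s \<in> on_obj S a" "t \<in> on_obj S b"
    using act_in[OF p(4) assms(3)] act_in[OF p(5) assms(3)] assms(4,5) by simp_all
  from the1_equality[OF S_pair_ex1[OF assms(1,2) this]] show ?thesis
    using assms(3-5) by (simp add: spair_def)
qed

text \<open>The sifted-colimit argument made explicit. For surjectivity onto pairs, triples over a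
  and b are combined into one over \<open>Prod C a b\<close>. For injectivity, the function
  \<open>m\<close> computes a class over p from representatives of its two projections and does not
  depend on which representatives are used.\<close>

lemma L_product:
  assumes p: "is_product C' c d p p1 p2"
  shows "is_product (SET \<kappa>) (on_obj L c) (on_obj L d) (on_obj L p) (on_arr L p1) (on_arr L p2)"
proof -
  note P = is_productD[OF p]
  \<comment> \<open>\<open>C'\<close> carries no chosen products and p is an arbitrary product cone,
    so pairing into p is taken by choice from the universal property.\<close>
  define tup where "tup f g = (SOME h. h \<in> hom C' (Dom C' f) p \<and> Comp C' p1 h = f \<and> Comp C' p2 h = g)"
    for f g
  have tup: "tup f g \<in> hom C' x p" "Comp C' p1 (tup f g) = f" "Comp C' p2 (tup f g) = g"
    if "f \<in> hom C' x c" "g \<in> hom C' x d" for f g x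
  proof -
    have "Dom C' f = x" using that by (simp add: hom_def)
    moreover have "\<exists>h. h \<in> hom C' x p \<and> Comp C' p1 h = f \<and> Comp C' p2 h = g"
      using product_pair[OF C' p that] by blast
    ultimately show "tup f g \<in> hom C' x p" "Comp C' p1 (tup f g) = f" "Comp C' p2 (tup f g) = g"
      using someI_ex[of "\<lambda>h. h \<in> hom C' x p \<and> Comp C' p1 h = f \<and> Comp C' p2 h = g"]
      by (simp_all add: tup_def)
  qed
  have tup_eqI: "tup f g = h" if "h \<in> hom C' x p" "Comp C' p1 h = f" "Comp C' p2 h = g" for f g h x
  proof -
    have "f \<in> hom C' x c" "g \<in> hom C' x d"
      using comp_hom[OF C' that(1) P(4)] comp_hom[OF C' that(1) P(5)] that(2,3) by simp_all
    note t = tup[OF this]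
    show ?thesis by (rule product_eqI[OF C' p t(1) that(1)]) (simp_all add: t that)
  qed
  \<comment> \<open>\<open>m\<close> induces the inverse of the comparison map \<open>L p \<rightarrow> L c \<times> L d\<close>: pair over the product in \<open>C\<close>.\<close>
  define m where "m x y = (case x of (a, f, s) \<Rightarrow> case y of (b, g, t) \<Rightarrow>
      cls p (Prod C a b, tup (Comp C' f (on_arr F (Pr1 C a b))) (Comp C' g (on_arr F (Pr2 C a b))),
        spair a b s t))" for x y
  \<comment> \<open>Both arguments move at once, along the arrow w = h x k. Putting an identity in
    one slot specialises this to each argument separately.\<close>
  have m_glue: "m (a, Comp C' f (on_arr F h), s) (b, Comp C' g (on_arr F k), t) =
      m (a', f, act h s) (b', g, act k t)"
    if h: "h \<in> hom C a a'" and k: "k \<in> hom C b b'" and f: "f \<in> hom C' (on_obj F a') c"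
      and g: "g \<in> hom C' (on_obj F b') d" and s: "s \<in> on_obj S a" and t: "t \<in> on_obj S b"
    for a a' b b' h k f g s t
  proof -
    note oa = hom_Obj[OF C h] and ob = hom_Obj[OF C k]
    note Q = is_productD[OF Prod_product[OF oa(1) ob(1)]]
    note q' = Prod_product[OF oa(2) ob(2)]
    note Q' = is_productD[OF q']
    obtain w where w: "w \<in> hom C (Prod C a b) (Prod C a' b')"
      "Comp C (Pr1 C a' b') w = Comp C h (Pr1 C a b)" "Comp C (Pr2 C a' b') w = Comp C k (Pr2 C a b)"
      using product_pair[OF C q' comp_hom[OF C Q(4) h] comp_hom[OF C Q(5) k]] by blast
    define u where "u = tup (Comp C' f (on_arr F (Pr1 C a' b'))) (Comp C' g (on_arr F (Pr2 C a' b')))"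
    note u = tup[OF comp_hom[OF C' functor_hom[OF F Q'(4)] f] comp_hom[OF C' functor_hom[OF F Q'(5)] g],
        folded u_def]
    note Fw = functor_hom[OF F w(1)]
    note z = spair[OF oa(1) ob(1) s t]
    have "tup (Comp C' (Comp C' f (on_arr F h)) (on_arr F (Pr1 C a b)))
        (Comp C' (Comp C' g (on_arr F k)) (on_arr F (Pr2 C a b))) = Comp C' u (on_arr F w)"
    proof (rule tup_eqI[OF comp_hom[OF C' Fw u(1)]])
      show "Comp C' p1 (Comp C' u (on_arr F w)) = Comp C' (Comp C' f (on_arr F h)) (on_arr F (Pr1 C a b))"
        using Comp_assoc[OF C' Fw u(1) P(4)] F_comp_assoc[OF w(1) Q'(4) f] F_comp_assoc[OF Q(4) h f] u(2) w(2)
        by simp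
      show "Comp C' p2 (Comp C' u (on_arr F w)) = Comp C' (Comp C' g (on_arr F k)) (on_arr F (Pr2 C a b))"
        using Comp_assoc[OF C' Fw u(1) P(5)] F_comp_assoc[OF w(1) Q'(5) g] F_comp_assoc[OF Q(5) k g] u(3) w(3)
        by simp
    qed
    moreover have "spair a' b' (act h s) (act k t) = act w (spair a b s t)"
    proof (rule spair_eqI[OF oa(2) ob(2) act_in[OF w(1) z(1)]])
      show "act (Pr1 C a' b') (act w (spair a b s t)) = act h s"
        using act_comp[OF w(1) Q'(4) z(1)] act_comp[OF Q(4) h z(1)] w(2) z(2) by simp
      show "act (Pr2 C a' b') (act w (spair a b s t)) = act k t"
        using act_comp[OF w(1) Q'(5) z(1)] act_comp[OF Q(5) k z(1)] w(3) z(3) by simp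
    qed
    ultimately show ?thesis
      using cls_glue[OF w(1) u(1) z(1)] by (simp add: m_def u_def)
  qed
  have id: "Comp C' f (on_arr F (Ident C a)) = f" if "a \<in> Obj C" "f \<in> hom C' (on_obj F a) x" for a f x
    using functor_id[OF F that(1)] comp_id(1)[OF C' that(2)] by simp
  have m_compatible_left: "compatible c (\<lambda>x. m x y)" if "y \<in> elems d" for y
    using that
  proof (rule elemsE)
    fix b g t assume y: "y = (b, g, t)" "b \<in> Obj C" "g \<in> hom C' (on_obj F b) d" "t \<in> on_obj S b"
    show ?thesis
      unfolding compatible_def
    proof (intro allI ballI)
      fix a a' h f s
      assume "h \<in> hom C a a'" "f \<in> hom C' (on_obj F a') c" "s \<in> on_obj S a"
      from m_glue[OF this(1) id_hom[OF C y(2)] this(2) y(3) this(3) y(4)]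
      show "m (a, Comp C' f (on_arr F h), s) y = m (a', f, act h s) y"
        by (simp add: y(1) id[OF y(2,3)] act_id[OF y(2,4)])
    qed
  qed
  have m_compatible_right: "compatible d (m x)" if "x \<in> elems c" for x
    using that
  proof (rule elemsE)
    fix a f s assume x: "x = (a, f, s)" "a \<in> Obj C" "f \<in> hom C' (on_obj F a) c" "s \<in> on_obj S a"
    show ?thesis
      unfolding compatible_def
    proof (intro allI ballI)
      fix b b' k g t
      assume "k \<in> hom C b b'" "g \<in> hom C' (on_obj F b') d" "t \<in> on_obj S b"
      from m_glue[OF id_hom[OF C x(2)] this(1) x(3) this(2) x(4) this(3)]
      show "m x (b, Comp C' g (on_arr F k), t) = m x (b', g, act k t)"
        by (simp add: x(1) id[OF x(2,3)] act_id[OF x(2,4)])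
    qed
  qed
  \<comment> \<open>Applied to the two projections of a triple, \<open>m\<close> returns the class
    of that triple; this makes the comparison map injective.\<close>
  have m_push: "m (push p1 x) (push p2 x) = cls p x" if "x \<in> elems p" for x
    using that
  proof (rule elemsE)
    fix a f s assume x: "x = (a, f, s)" "a \<in> Obj C" "f \<in> hom C' (on_obj F a) p" "s \<in> on_obj S a"
    note q = Prod_product[OF x(2,2)]
    note Q = is_productD[OF q]
    \<comment> \<open>The pair of the two projections of \<open>x\<close> is glued to \<open>x\<close> along the diagonal \<open>w\<close>.\<close>
    obtain w where w: "w \<in> hom C a (Prod C a a)" "Comp C (Pr1 C a a) w = Ident C a"
      "Comp C (Pr2 C a a) w = Ident C a"
      using product_pair[OF C q id_hom[OF C x(2)] id_hom[OF C x(2)]] by blast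
    note f = comp_hom[OF C' x(3) P(4)] comp_hom[OF C' x(3) P(5)]
    define u where "u = tup (Comp C' (Comp C' p1 f) (on_arr F (Pr1 C a a)))
        (Comp C' (Comp C' p2 f) (on_arr F (Pr2 C a a)))"
    note u = tup[OF comp_hom[OF C' functor_hom[OF F Q(4)] f(1)] comp_hom[OF C' functor_hom[OF F Q(5)] f(2)],
        folded u_def]
    note Fw = functor_hom[OF F w(1)]
    have "Comp C' u (on_arr F w) = f"
    proof (rule product_eqI[OF C' p comp_hom[OF C' Fw u(1)] x(3)])
      show "Comp C' p1 (Comp C' u (on_arr F w)) = Comp C' p1 f"
        using Comp_assoc[OF C' Fw u(1) P(4)] F_comp_assoc[OF w(1) Q(4) f(1)] u(2) w(2) id[OF x(2) f(1)]
        by simp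
      show "Comp C' p2 (Comp C' u (on_arr F w)) = Comp C' p2 f"
        using Comp_assoc[OF C' Fw u(1) P(5)] F_comp_assoc[OF w(1) Q(5) f(2)] u(3) w(3) id[OF x(2) f(2)]
        by simp
    qed
    moreover have "spair a a s s = act w s"
      using act_comp[OF w(1) Q(4) x(4)] act_comp[OF w(1) Q(5) x(4)] w(2,3) act_id[OF x(2,4)]
      by (intro spair_eqI[OF x(2,2) act_in[OF w(1) x(4)]]) simp_all
    ultimately show ?thesis
      using cls_glue[OF w(1) u(1) x(4)] by (simp add: m_def u_def x(1))
  qed
  have "\<exists>!z. z \<in> L_set p \<and> arr (on_arr L p1) z = i \<and> arr (on_arr L p2) z = j"
    if ij: "i \<in> L_set c" "j \<in> L_set d" for i j
  proof (rule ex_ex1I)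
    obtain x y where xy: "i = cls c x" "x \<in> elems c" "j = cls d y" "y \<in> elems d"
      using ij by (auto simp: L_set_def)
    obtain a f s where x: "x = (a, f, s)" "a \<in> Obj C" "f \<in> hom C' (on_obj F a) c" "s \<in> on_obj S a"
      using xy(2) by (rule elemsE)
    obtain b g t where y: "y = (b, g, t)" "b \<in> Obj C" "g \<in> hom C' (on_obj F b) d" "t \<in> on_obj S b"
      using xy(4) by (rule elemsE)
    note Q = is_productD[OF Prod_product[OF x(2) y(2)]]
    note u = tup[OF comp_hom[OF C' functor_hom[OF F Q(4)] x(3)] comp_hom[OF C' functor_hom[OF F Q(5)] y(3)]]
    note z = spair[OF x(2) y(2) x(4) y(4)]
    let ?e = "(Prod C a b, tup (Comp C' f (on_arr F (Pr1 C a b))) (Comp C' g (on_arr F (Pr2 C a b))),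
        spair a b s t)"
    have e: "?e \<in> elems p" by (rule elemsI[OF u(1) Q(3) z(1)])
    \<comment> \<open>The first projection of \<open>?e\<close> consists of
      \<open>Prod C a b\<close>, the arrow f after F \<open>Pr1\<close>, and the paired element.
      Gluing along \<open>Pr1\<close> moves it to \<open>(a, f, s)\<close>; the second projection is
      symmetric.\<close>
    have "arr (on_arr L p1) (cls p ?e) = i" "arr (on_arr L p2) (cls p ?e) = j"
      using L_arr_cls[OF P(4) e] L_arr_cls[OF P(5) e] u(2,3) z(2,3)
        cls_glue[OF Q(4) x(3) z(1)] cls_glue[OF Q(5) y(3) z(1)]
      by (simp_all add: xy x(1) y(1))
    then show "\<exists>z. z \<in> L_set p \<and> arr (on_arr L p1) z = i \<and> arr (on_arr L p2) z = j"
      using e unfolding L_set_def by blast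
  next
    fix z z'
    assume z: "z \<in> L_set p \<and> arr (on_arr L p1) z = i \<and> arr (on_arr L p2) z = j"
      and z': "z' \<in> L_set p \<and> arr (on_arr L p1) z' = i \<and> arr (on_arr L p2) z' = j"
    obtain x x' where x: "z = cls p x" "x \<in> elems p" and x': "z' = cls p x'" "x' \<in> elems p"
      using z z' by (auto simp: L_set_def)
    have "cls c (push p1 x) = cls c (push p1 x')" "cls d (push p2 x) = cls d (push p2 x')"
      using z z' L_arr_cls[OF P(4) x(2)] L_arr_cls[OF P(4) x'(2)] L_arr_cls[OF P(5) x(2)] L_arr_cls[OF P(5) x'(2)]
      by (simp_all add: x(1) x'(1))
    \<comment> \<open>Equal classes give equal values of compatible functions. Since
      \<open>m\<close> is compatible in one argument at a time, the representatives are exchanged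
      one after the other through a mixed term.\<close>
    then have "m (push p1 x) (push p2 x) = m (push p1 x') (push p2 x)"
      "m (push p1 x') (push p2 x) = m (push p1 x') (push p2 x')"
      using cls_eq_iff[OF P(1) push_elems[OF P(4) x(2)] push_elems[OF P(4) x'(2)]]
        cls_eq_iff[OF P(2) push_elems[OF P(5) x(2)] push_elems[OF P(5) x'(2)]]
        m_compatible_left[OF push_elems[OF P(5) x(2)]] m_compatible_right[OF push_elems[OF P(4) x'(2)]]
      by blast+
    then show "z = z'" using m_push[OF x(2)] m_push[OF x'(2)] x(1) x'(1) by simp
  qed
  then show ?thesis
    using is_product_SET[OF infinite_universe L_arr_hom[OF P(4)] L_arr_hom[OF P(5)]]
    by (simp add: L_obj P)
qed

lemma L_funmod: "is_funmod C' (SET \<kappa>) L"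
  using L_functor L_terminal L_product by (simp add: is_funmod_def preserves_finite_products_def)

section \<open>The unit and its universal property\<close>

definition unit_component :: "'o \<Rightarrow> ('u set, 'u \<Rightarrow> 'u) arrow" where
  "unit_component a = Arrow (on_obj S a)
     (\<lambda>s\<in>on_obj S a. cls (on_obj F a) (a, Ident C' (on_obj F a), s)) (L_set (on_obj F a))"

definition unit where
  "unit = Arrow S (\<lambda>a\<in>Obj C. unit_component a) (func_comp C L F)"

lemma unit_elems: "a \<in> Obj C \<Longrightarrow> s \<in> on_obj S a \<Longrightarrow> (a, Ident C' (on_obj F a), s) \<in> elems (on_obj F a)"
  by (intro elemsI id_hom[OF C' functor_obj[OF F]])

lemma unit_app: "s \<in> on_obj S a \<Longrightarrow> arr (unit_component a) s = cls (on_obj F a) (a, Ident C' (on_obj F a), s)"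
  by (simp add: unit_component_def)

lemma unit_component_hom:
  "a \<in> Obj C \<Longrightarrow> unit_component a \<in> hom (SET \<kappa>) (on_obj S a) (L_set (on_obj F a))"
  unfolding unit_component_def
  using functor_obj[OF S_functor] L_set_small[OF functor_obj[OF F]] unit_elems
  by (intro SET_homI) (auto simp: L_set_def)

text \<open>Naturality is the gluing equation at an identity arrow: (a, F h, s) and (b, id, S h s)
  lie in the same class.\<close>

lemma unit_hom: "unit \<in> hom (FunMod C (SET \<kappa>)) S (func_comp C L F)"
proof -
  have "is_nat_trans C (SET \<kappa>) S (func_comp C L F) (\<lambda>a\<in>Obj C. unit_component a)"
  proof (rule is_nat_transI[OF S_functor is_functor_func_comp[OF F L_functor]])
    show "(\<lambda>a\<in>Obj C. unit_component a) a \<in> hom (SET \<kappa>) (on_obj S a) (on_obj (func_comp C L F) a)"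
      if "a \<in> Obj C" for a
      using unit_component_hom[OF that] that by (simp add: L_obj functor_obj[OF F])
    fix h a b assume h: "h \<in> hom C a b"
    note o = hom_Obj[OF C h]
    note Fo = o[THEN functor_obj[OF F]] and Fh = functor_hom[OF F h]
    have "Comp (SET \<kappa>) (unit_component b) (on_arr S h) = Comp (SET \<kappa>) (on_arr L (on_arr F h)) (unit_component a)"
    proof (rule SET_hom_eqI[OF comp_hom[OF category_SET functor_hom[OF S_functor h] unit_component_hom[OF o(2)]]
          comp_hom[OF category_SET unit_component_hom[OF o(1)] L_arr_hom[OF Fh]]])
      fix s assume s: "s \<in> on_obj S a"
      show "arr (Comp (SET \<kappa>) (unit_component b) (on_arr S h)) s =
          arr (Comp (SET \<kappa>) (on_arr L (on_arr F h)) (unit_component a)) s"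
        using SET_comp_app[OF functor_hom[OF S_functor h] s] SET_comp_app[OF unit_component_hom[OF o(1)] s]
          unit_app[OF s] unit_app[OF act_in[OF h s]] L_arr_cls[OF Fh unit_elems[OF o(1) s]]
          cls_glue[OF h id_hom[OF C' Fo(2)] s] comp_id[OF C' Fh]
        by simp
    qed
    then show "Comp (SET \<kappa>) ((\<lambda>a\<in>Obj C. unit_component a) b) (on_arr S h) =
        Comp (SET \<kappa>) (on_arr (func_comp C L F) h) ((\<lambda>a\<in>Obj C. unit_component a) a)"
      using o hom_in_Arr[OF h] by simp
  qed simp
  then show ?thesis
    using is_funmod_func_comp[OF F F_prod L_funmod] S by (simp add: FunMod_hom unit_def)
qed

text \<open>The class of (a, f, s) is L f applied to the unit at s, so a transformation out of
  \<open>L\<close> that extends \<open>\<beta>\<close> must send it to R f applied to the value of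
  \<open>\<beta>\<close> at s. This determines \<open>\<gamma>\<close>, and naturality of
  \<open>\<beta>\<close> makes the prescription respect the gluing.\<close>

lemma unit_universal:
  assumes R: "is_funmod C' (SET \<kappa>) R"
    and \<beta>: "\<beta> \<in> hom (FunMod C (SET \<kappa>)) S (func_comp C R F)"
  shows "\<exists>!\<gamma>. \<gamma> \<in> hom (FunMod C' (SET \<kappa>)) L R \<and>
    Comp (FunMod C (SET \<kappa>)) (on_arr (algebraic_functor C C' F (SET \<kappa>)) \<gamma>) unit = \<beta>"
proof -
  note R_functor = is_funmodD(1)[OF R]
  obtain b where b: "\<beta> = Arrow S b (func_comp C R F)" "is_nat_trans C (SET \<kappa>) S (func_comp C R F) b"
    using \<beta> by (auto simp: FunMod_hom)
  note B = nat_transD[OF b(2)]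
  have b_hom: "b a \<in> hom (SET \<kappa>) (on_obj S a) (on_obj R (on_obj F a))" if "a \<in> Obj C" for a
    using B(4)[OF that] that by simp
  have b_nat: "arr (b a') (act h s) = arr (on_arr R (on_arr F h)) (arr (b a) s)"
    if h: "h \<in> hom C a a'" and s: "s \<in> on_obj S a" for a a' h s
    using arg_cong[OF B(5)[OF h], of "\<lambda>f. arr f s"] hom_in_Arr[OF h]
      SET_comp_app[OF functor_hom[OF S_functor h] s] SET_comp_app[OF b_hom[OF hom_Obj(1)[OF C h]] s]
    by simp
  have R_comp: "arr (on_arr R (Comp C' g f)) x = arr (on_arr R g) (arr (on_arr R f) x)"
    if "f \<in> hom C' u v" "g \<in> hom C' v w" "x \<in> on_obj R u" for f g u v w x
    using functor_comp[OF R_functor that(1,2)] SET_comp_app[OF functor_hom[OF R_functor that(1)] that(3)]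
    by simp
  define ev where "ev = (\<lambda>(a, f, s). arr (on_arr R f) (arr (b a) s))"
  have ev_in: "ev x \<in> on_obj R c" if "x \<in> elems c" for x c
    using that SET_app[OF functor_hom[OF R_functor]] SET_app[OF b_hom] by (auto elim!: elemsE simp: ev_def)
  have ev_compatible: "compatible c ev" for c
    unfolding compatible_def
  proof (intro allI ballI)
    fix a a' h f s assume h: "h \<in> hom C a a'" and f: "f \<in> hom C' (on_obj F a') c" and s: "s \<in> on_obj S a"
    show "ev (a, Comp C' f (on_arr F h), s) = ev (a', f, act h s)"
      using R_comp[OF functor_hom[OF F h] f SET_app[OF b_hom[OF hom_Obj(1)[OF C h]] s]] b_nat[OF h s]
      by (simp add: ev_def)
  qed
  define comp where "comp c = Arrow (L_set c) (\<lambda>z\<in>L_set c. lift c ev z) (on_obj R c)" for c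
  have comp_hom': "comp c \<in> hom (SET \<kappa>) (on_obj L c) (on_obj R c)" if c: "c \<in> Obj C'" for c
    unfolding comp_def L_obj[OF c]
    using L_set_small[OF c] functor_obj[OF R_functor c] lift_L_set[OF c ev_compatible ev_in]
    by (intro SET_homI) simp_all
  have comp_app: "arr (comp c) (cls c x) = ev x" if "c \<in> Obj C'" "x \<in> elems c" for c x
    using lift_cls[OF that(1) ev_compatible that(2)] that(2) by (simp add: comp_def L_set_def)
  define \<gamma> where "\<gamma> = Arrow L (\<lambda>c\<in>Obj C'. comp c) R"
  have "is_nat_trans C' (SET \<kappa>) L R (\<lambda>c\<in>Obj C'. comp c)"
  proof (rule is_nat_transI[OF L_functor R_functor])
    show "(\<lambda>c\<in>Obj C'. comp c) c \<in> hom (SET \<kappa>) (on_obj L c) (on_obj R c)" if "c \<in> Obj C'" for c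
      using comp_hom'[OF that] that by simp
    fix k c d assume k: "k \<in> hom C' c d"
    note o = hom_Obj[OF C' k]
    have "Comp (SET \<kappa>) (comp d) (on_arr L k) = Comp (SET \<kappa>) (on_arr R k) (comp c)"
    proof (rule SET_hom_eqI[OF comp_hom[OF category_SET functor_hom[OF L_functor k] comp_hom'[OF o(2)]]
          comp_hom[OF category_SET comp_hom'[OF o(1)] functor_hom[OF R_functor k]]])
      fix z assume z: "z \<in> on_obj L c"
      then obtain x where x: "z = cls c x" "x \<in> elems c" by (auto simp: L_obj[OF o(1)] L_set_def)
      obtain a f s where afs: "x = (a, f, s)" "a \<in> Obj C" "f \<in> hom C' (on_obj F a) c" "s \<in> on_obj S a"
        using x(2) by (rule elemsE)
      have "ev (push k x) = arr (on_arr R k) (ev x)"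
        using R_comp[OF afs(3) k SET_app[OF b_hom[OF afs(2)] afs(4)]] by (simp add: ev_def afs(1))
      then show "arr (Comp (SET \<kappa>) (comp d) (on_arr L k)) z = arr (Comp (SET \<kappa>) (on_arr R k) (comp c)) z"
        using SET_comp_app[OF functor_hom[OF L_functor k] z] SET_comp_app[OF comp_hom'[OF o(1)] z]
          L_arr_cls[OF k x(2)] comp_app[OF o(1) x(2)] comp_app[OF o(2) push_elems[OF k x(2)]]
        by (simp add: x(1))
    qed
    then show "Comp (SET \<kappa>) ((\<lambda>c\<in>Obj C'. comp c) d) (on_arr L k) =
        Comp (SET \<kappa>) (on_arr R k) ((\<lambda>c\<in>Obj C'. comp c) c)"
      using o by simp
  qed simp
  then have \<gamma>_hom: "\<gamma> \<in> hom (FunMod C' (SET \<kappa>)) L R"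
    using L_funmod R by (simp add: FunMod_hom \<gamma>_def)
  \<comment> \<open>Restriction along F evaluates \<open>\<delta>\<close> at F a, so the equation
    with \<open>\<beta>\<close> amounts to one equation of functions for each a.\<close>
  have restrict: "Comp (FunMod C (SET \<kappa>)) (on_arr (algebraic_functor C C' F (SET \<kappa>)) \<delta>) unit =
      Arrow S (\<lambda>a\<in>Obj C. Comp (SET \<kappa>) (arr \<delta> (on_obj F a)) (unit_component a)) (func_comp C R F)"
    if "\<delta> \<in> hom (FunMod C' (SET \<kappa>)) L R" for \<delta>
    using hom_in_Arr[OF that] that by (auto simp: algebraic_functor_def unit_def FunMod_hom fun_eq_iff)
  have "Comp (SET \<kappa>) (comp (on_obj F a)) (unit_component a) = b a" if a: "a \<in> Obj C" for a
  proof -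
    note Fa = functor_obj[OF F a]
    note c = comp_hom'[OF Fa, unfolded L_obj[OF Fa]]
    show ?thesis
    proof (rule SET_hom_eqI[OF comp_hom[OF category_SET unit_component_hom[OF a] c] b_hom[OF a]])
      fix s assume s: "s \<in> on_obj S a"
      have "arr (on_arr R (Ident C' (on_obj F a))) (arr (b a) s) = arr (b a) s"
        using functor_id[OF R_functor Fa] SET_id_app[OF SET_app[OF b_hom[OF a] s]] by simp
      then show "arr (Comp (SET \<kappa>) (comp (on_obj F a)) (unit_component a)) s = arr (b a) s"
        using SET_comp_app[OF unit_component_hom[OF a] s] unit_app[OF s] comp_app[OF Fa unit_elems[OF a s]]
        by (simp add: ev_def)
    qed
  qed
  then have "(\<lambda>a\<in>Obj C. Comp (SET \<kappa>) (arr \<gamma> (on_obj F a)) (unit_component a)) = b"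
    using B(3) functor_obj[OF F] by (auto simp: fun_eq_iff extensional_def \<gamma>_def)
  then have \<gamma>_unit: "Comp (FunMod C (SET \<kappa>)) (on_arr (algebraic_functor C C' F (SET \<kappa>)) \<gamma>) unit = \<beta>"
    using restrict[OF \<gamma>_hom] b(1) by simp
  have "\<delta> = \<gamma>" if \<delta>: "\<delta> \<in> hom (FunMod C' (SET \<kappa>)) L R"
    and \<delta>_unit: "Comp (FunMod C (SET \<kappa>)) (on_arr (algebraic_functor C C' F (SET \<kappa>)) \<delta>) unit = \<beta>" for \<delta>
  proof -
    obtain t where t: "\<delta> = Arrow L t R" "is_nat_trans C' (SET \<kappa>) L R t"
      using \<delta> by (auto simp: FunMod_hom)
    note T = nat_transD[OF t(2)]
    have tb: "Comp (SET \<kappa>) (t (on_obj F a)) (unit_component a) = b a" if "a \<in> Obj C" for a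
      using restrict[OF \<delta>] \<delta>_unit b(1) t(1) that by (auto dest: fun_cong[of _ _ a])
    have "t c = comp c" if c: "c \<in> Obj C'" for c
    proof (rule SET_hom_eqI[OF T(4)[OF c] comp_hom'[OF c]])
      fix z assume "z \<in> on_obj L c"
      then obtain x where x: "z = cls c x" "x \<in> elems c" by (auto simp: L_obj[OF c] L_set_def)
      obtain a f s where afs: "x = (a, f, s)" "a \<in> Obj C" "f \<in> hom C' (on_obj F a) c" "s \<in> on_obj S a"
        using x(2) by (rule elemsE)
      let ?e = "cls (on_obj F a) (a, Ident C' (on_obj F a), s)"
      note Fa = functor_obj[OF F afs(2)] and e = unit_elems[OF afs(2,4)]
      have e_L: "?e \<in> on_obj L (on_obj F a)" using e by (simp add: L_obj[OF Fa] L_set_def)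
      have z: "z = arr (on_arr L f) ?e"
        using L_arr_cls[OF afs(3) e] comp_id(1)[OF C' afs(3)] by (simp add: x(1) afs(1))
      have "arr (t c) z = arr (on_arr R f) (arr (t (on_obj F a)) ?e)"
        using arg_cong[OF T(5)[OF afs(3)], of "\<lambda>g. arr g ?e"]
          SET_comp_app[OF functor_hom[OF L_functor afs(3)] e_L] SET_comp_app[OF T(4)[OF Fa] e_L]
        by (simp add: z)
      also have "arr (t (on_obj F a)) ?e = arr (b a) s"
        using arg_cong[OF tb[OF afs(2)], of "\<lambda>g. arr g s"]
          SET_comp_app[OF unit_component_hom[OF afs(2)] afs(4)] unit_app[OF afs(4)]
        by simp
      finally show "arr (t c) z = arr (comp c) z"
        using comp_app[OF c x(2)] by (simp add: x(1) afs(1) ev_def)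
    qed
    then have "t = (\<lambda>c\<in>Obj C'. comp c)"
      using T(3) by (auto simp: fun_eq_iff extensional_def)
    then show ?thesis by (simp add: \<gamma>_def t(1))
  qed
  then show ?thesis using \<gamma>_hom \<gamma>_unit by blast
qed

end

section \<open>Algebraic functors have left adjoints\<close>

text \<open>The construction for a fixed model supplies, at each S, the universal arrow
  \<open>unit\<close> into the restriction of \<open>L\<close>; universal arrows at all S amount to
  a left adjoint.\<close>

theorem algebraic_functor_has_left_adjoint:
  fixes C :: "('o, 'm, 'z) cartcat_scheme" and C' :: "('p, 'n, 'y) cat_scheme"
  assumes universe: "set_universe \<kappa>"
    and C: "cartesian_category C" "|Obj C| <o \<kappa>"
    and C': "locally_small \<kappa> C'"
    and F: "is_functor C C' F" "preserves_finite_products C C' F"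
  shows "has_left_adjoint (FunMod C' (SET \<kappa>)) (FunMod C (SET \<kappa>)) (algebraic_functor C C' F (SET \<kappa>))"
proof (rule has_left_adjointI[OF is_functor_algebraic_functor[OF F]])
  fix S assume "S \<in> Obj (FunMod C (SET \<kappa>))"
  then interpret kan_extension \<kappa> C C' F S
    using assms by unfold_locales simp_all
  have obj: "on_obj (algebraic_functor C C' F (SET \<kappa>)) R = func_comp C R F"
    if "R \<in> Obj (FunMod C' (SET \<kappa>))" for R
    using that by (simp add: algebraic_functor_def)
  show "\<exists>l\<in>Obj (FunMod C' (SET \<kappa>)).
      \<exists>\<eta>\<in>hom (FunMod C (SET \<kappa>)) S (on_obj (algebraic_functor C C' F (SET \<kappa>)) l).
      \<forall>R\<in>Obj (FunMod C' (SET \<kappa>)).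
      \<forall>\<beta>\<in>hom (FunMod C (SET \<kappa>)) S (on_obj (algebraic_functor C C' F (SET \<kappa>)) R).
      \<exists>!\<gamma>. \<gamma> \<in> hom (FunMod C' (SET \<kappa>)) l R \<and>
        Comp (FunMod C (SET \<kappa>)) (on_arr (algebraic_functor C C' F (SET \<kappa>)) \<gamma>) \<eta> = \<beta>"
  proof (intro bexI[of _ L] bexI[of _ unit] ballI)
    show L: "L \<in> Obj (FunMod C' (SET \<kappa>))" using L_funmod by simp
    show "unit \<in> hom (FunMod C (SET \<kappa>)) S (on_obj (algebraic_functor C C' F (SET \<kappa>)) L)"
      unfolding obj[OF L] by (rule unit_hom)
    fix R \<beta> assume R: "R \<in> Obj (FunMod C' (SET \<kappa>))"
      and \<beta>: "\<beta> \<in> hom (FunMod C (SET \<kappa>)) S (on_obj (algebraic_functor C C' F (SET \<kappa>)) R)"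
    show "\<exists>!\<gamma>. \<gamma> \<in> hom (FunMod C' (SET \<kappa>)) L R \<and>
        Comp (FunMod C (SET \<kappa>)) (on_arr (algebraic_functor C C' F (SET \<kappa>)) \<gamma>) unit = \<beta>"
      using R by (intro unit_universal \<beta>[unfolded obj[OF R]]) simp
  qed
qed

section \<open>From algebraic translations to product-preserving functors\<close>

lemma strict_cartesian_preserves_finite_products:
  assumes T: "strict_cartesian_functor C D T" and C: "cartesian_category C" and D: "cartesian_category D"
  shows "preserves_finite_products C D T"
proof (rule preserves_finite_productsI[OF C])
  show fT: "is_functor C D T" using T by (simp add: strict_cartesian_functor_def)
  show "is_terminal D (on_obj T (One C))"
    using T D by (simp add: strict_cartesian_functor_def cartesian_category_def)
  show "is_product D (on_obj T a) (on_obj T b) (on_obj T (Prod C a b))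
      (on_arr T (Pr1 C a b)) (on_arr T (Pr2 C a b))" if "a \<in> Obj C" "b \<in> Obj C" for a b
    using T D that functor_obj[OF fT] by (simp add: strict_cartesian_functor_def cartesian_category_def)
qed

text \<open>T and T' are strict and the identity on objects, so the terminal object, products and
  projections of both theories are images of those of \<open>MM\<close>. The equation T' = F T then
  makes F the identity on objects and sends the projections of \<open>TT\<close> to those of
  \<open>TT'\<close>.\<close>

lemma algebraic_translation_strict_cartesian:
  assumes T: "second_order_theory TT T" and T': "second_order_theory TT' T'"
    and F: "algebraic_translation TT T TT' T' F"
  shows "strict_cartesian_functor TT TT' F"
proof -
  have eq: "T' = func_comp MM F T" and F_functor: "is_functor TT TT' F"
    using F by (simp_all add: algebraic_translation_def)
  have T_obj: "on_obj T x = x" "on_obj T' x = x" for x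
    using T T' by (simp_all add: second_order_theory_def)
  then have F_obj: "on_obj F x = x" for x
    using func_comp_sel(1)[of x MM F T] by (simp add: eq)
  have F_arr: "on_arr F (on_arr T h) = on_arr T' h" if "h \<in> hom MM a b" for h a b
    using hom_in_Arr[OF that] by (simp add: eq)
  have "One TT = []" "One TT' = []" "Prod TT a b = a @ b" "Prod TT' a b = a @ b"
    "Pr1 TT a b = on_arr T (Pr1 MM a b)" "Pr1 TT' a b = on_arr T' (Pr1 MM a b)"
    "Pr2 TT a b = on_arr T (Pr2 MM a b)" "Pr2 TT' a b = on_arr T' (Pr2 MM a b)" for a b
    using T T' unfolding second_order_theory_def strict_cartesian_functor_def by (simp_all add: T_obj)
  then show ?thesis
    using F_functor F_arr[OF Pr1_MM] F_arr[OF Pr2_MM]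
    by (simp add: strict_cartesian_functor_def F_obj)
qed

theorem theorem5:
  fixes \<kappa> :: "'u rel"
    and TT :: "(nat list, 'm) cartcat"
    and TT' :: "(nat list, 'n) cartcat"
    and T :: "(nat list, (nat list, trm list) arrow, nat list, 'm) func"
    and T' :: "(nat list, (nat list, trm list) arrow, nat list, 'n) func"
    and F :: "(nat list, 'm, nat list, 'n) func"
  assumes "set_universe \<kappa>"
    and "second_order_theory TT T" and "locally_small \<kappa> TT"
    and "second_order_theory TT' T'" and "locally_small \<kappa> TT'"
    and "algebraic_translation TT T TT' T' F"
  shows "has_left_adjoint (FunMod TT' (SET \<kappa>)) (FunMod TT (SET \<kappa>))
           (algebraic_functor TT TT' F (SET \<kappa>))"
proof (rule algebraic_functor_has_left_adjoint[OF assms(1) _ _ assms(5)])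
  show C: "cartesian_category TT" using assms(2) by (simp add: second_order_theory_def)
  have C': "cartesian_category TT'" using assms(4) by (simp add: second_order_theory_def)
  have F: "strict_cartesian_functor TT TT' F"
    by (rule algebraic_translation_strict_cartesian[OF assms(2,4,6)])
  then show "is_functor TT TT' F" by (simp add: strict_cartesian_functor_def)
  show "preserves_finite_products TT TT' F"
    by (rule strict_cartesian_preserves_finite_products[OF F C C'])
  \<comment> \<open>Strictness of \<open>natLeq <o \<kappa>\<close> matters for the bound derived
    from this: the objects are all of \<open>nat list\<close>, a countably infinite type.\<close>
  have "|Obj TT| \<le>o natLeq"
    using countableI_type[of "Obj TT"] by (simp only: countable_card_le_natLeq)
  then show "|Obj TT| <o \<kappa>"
    using assms(1) ordLeq_ordLess_trans unfolding set_universe_def by blast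
qed
end
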